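(* Let $\Omega\subseteq\mathbb C^d$ be a domain containing the origin $\mathbf 0$, and let $k$ be a diagonal holomorphic kernel on $\Omega$ with associated reproducing kernel Hilbert space $\mathcal H(k)$. Assume that for every $w\in\Omega$ the function $k_w^2: z\mapsto k(z,w)^2$ belongs to $\mathcal H(k)$. Let $\Lambda:\mathcal H(k)\to\mathbb C$ be a bounded linear functional satisfying $\Lambda(1)=1$. Then the following statements are equivalent: (1) $\Lambda$ is multiplicative; (2) $\Lambda(k_w^2)=\Lambda(k_w)^2$ for every $w\in\Omega$.
   Context: A reproducing kernel $k$ on a domain $\Omega\subseteq\mathbb C^d$ containing $\mathbf 0$ is a diagonal holomorphic kernel if it is holomorphic in the first variable, anti-holomorphic in the second variable, and there is a family of (strictly) positive numbers $\{a_\alpha\}_{\alpha\in\mathbb Z_+^d}$ such that the power series expansion of $k$ at $\mathbf 0$ is $k(z,w)=\sum_{\alpha\in\mathbb Z_+^d}a_\alpha z^\alpha\overline{w}^{\,\alpha}$ (standard multi-index notation; $\mathbb Z_+$ is the set of non-negative integers). For $w\in\Omega$, $k_w$ denotes the kernel function $z\mapsto k(z,w)$. A linear functional $\Lambda$ on $\mathcal H(k)$ is called multiplicative if $\Lambda(fg)=\Lambda(f)\Lambda(g)$ whenever $f,g\in\mathcal H(k)$ are such that the pointwise product $fg$ is also in $\mathcal H(k)$. *)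

theory Defs
  imports "HOL-Analysis.Analysis"
begin

text \<open>
  A function on a set \<open>\<Omega>\<close> of complex vectors is represented by a total function that is
  zero outside \<open>\<Omega>\<close>. This convention makes functions on \<open>\<Omega>\<close> equal iff they agree on \<open>\<Omega>\<close>, and
  it is preserved by sums, scalar multiples and pointwise products.
\<close>

definition zero_ext :: "(complex ^ 'd) set \<Rightarrow> (complex ^ 'd \<Rightarrow> complex) \<Rightarrow> complex ^ 'd \<Rightarrow> complex" where
  "zero_ext \<Omega> f = (\<lambda>z. if z \<in> \<Omega> then f z else 0)"

text \<open>Holomorphy in several variables: real Frechet differentiability with a
  complex-linear derivative at every point. Meant for open \<open>\<Omega>\<close>.\<close>

definition holomorphic_several :: "(complex ^ 'd \<Rightarrow> complex) \<Rightarrow> (complex ^ 'd) set \<Rightarrow> bool" where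
  "holomorphic_several f \<Omega> \<longleftrightarrow>
     (\<forall>z\<in>\<Omega>. \<exists>f'. (f has_derivative f') (at z) \<and> (\<forall>c v. f' (c *s v) = c * f' v))"

definition multi_power :: "complex ^ 'd \<Rightarrow> nat ^ 'd \<Rightarrow> complex" where
  "multi_power z \<alpha> = (\<Prod>i\<in>UNIV. (z $ i) ^ (\<alpha> $ i))"

text \<open>
  The expansion at the origin is required on some neighbourhood of it only; the series over all
  multi-indices is an unordered (hence absolutely convergent) sum. That \<open>k\<close> is a reproducing
  kernel is expressed by \<open>rkhs\<close> below.
\<close>

definition diagonal_holomorphic_kernel ::
    "(complex ^ 'd) set \<Rightarrow> (complex ^ 'd \<Rightarrow> complex ^ 'd \<Rightarrow> complex) \<Rightarrow> bool" where
  "diagonal_holomorphic_kernel \<Omega> k \<longleftrightarrow>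
     (\<forall>w\<in>\<Omega>. holomorphic_several (\<lambda>z. k z w) \<Omega>) \<and>
     (\<forall>z\<in>\<Omega>. holomorphic_several (\<lambda>w. cnj (k z w)) \<Omega>) \<and>
     (\<exists>a :: nat ^ 'd \<Rightarrow> real. (\<forall>\<alpha>. a \<alpha> > 0) \<and>
        (\<exists>r>0. ball 0 r \<subseteq> \<Omega> \<and>
           (\<forall>z\<in>ball 0 r. \<forall>w\<in>ball 0 r.
              ((\<lambda>\<alpha>. complex_of_real (a \<alpha>) * multi_power z \<alpha> * cnj (multi_power w \<alpha>))
                 has_sum k z w) UNIV)))"

definition ip_norm :: "('f \<Rightarrow> 'f \<Rightarrow> complex) \<Rightarrow> 'f \<Rightarrow> real" where
  "ip_norm ip f = sqrt (Re (ip f f))"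

text \<open>A complex Hilbert space \<open>H\<close> of functions on \<open>\<Omega>\<close>, with inner product \<open>ip\<close> linear in the
  first argument.\<close>

locale function_hilbert_space =
  fixes \<Omega> :: "(complex ^ 'd) set"
    and H :: "(complex ^ 'd \<Rightarrow> complex) set"
    and ip :: "(complex ^ 'd \<Rightarrow> complex) \<Rightarrow> (complex ^ 'd \<Rightarrow> complex) \<Rightarrow> complex"
  assumes zero_outside: "f \<in> H \<Longrightarrow> z \<notin> \<Omega> \<Longrightarrow> f z = 0"
    and zero_mem: "(\<lambda>z. 0) \<in> H"
    and add_mem: "f \<in> H \<Longrightarrow> g \<in> H \<Longrightarrow> (\<lambda>z. f z + g z) \<in> H"
    and scale_mem: "f \<in> H \<Longrightarrow> (\<lambda>z. c * f z) \<in> H"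
    and ip_add: "f \<in> H \<Longrightarrow> g \<in> H \<Longrightarrow> h \<in> H \<Longrightarrow> ip (\<lambda>z. f z + g z) h = ip f h + ip g h"
    and ip_scale: "f \<in> H \<Longrightarrow> h \<in> H \<Longrightarrow> ip (\<lambda>z. c * f z) h = c * ip f h"
    and ip_commute: "f \<in> H \<Longrightarrow> g \<in> H \<Longrightarrow> ip g f = cnj (ip f g)"
    and ip_nonneg: "f \<in> H \<Longrightarrow> 0 \<le> Re (ip f f)"
    and ip_definite: "f \<in> H \<Longrightarrow> ip f f = 0 \<Longrightarrow> f = (\<lambda>z. 0)"
    and complete: "(\<And>n::nat. X n \<in> H) \<Longrightarrow>
      (\<And>e. e > 0 \<Longrightarrow> \<exists>N. \<forall>m\<ge>N. \<forall>n\<ge>N. ip_norm ip (\<lambda>z. X m z - X n z) < e) \<Longrightarrow>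
      \<exists>f\<in>H. (\<lambda>n. ip_norm ip (\<lambda>z. X n z - f z)) \<longlonglongrightarrow> 0"

definition kernel_fun ::
    "(complex ^ 'd) set \<Rightarrow> (complex ^ 'd \<Rightarrow> complex ^ 'd \<Rightarrow> complex) \<Rightarrow> complex ^ 'd
      \<Rightarrow> complex ^ 'd \<Rightarrow> complex" where
  "kernel_fun \<Omega> k w = zero_ext \<Omega> (\<lambda>z. k z w)"

text \<open>\<open>H\<close> with \<open>ip\<close> is a reproducing kernel Hilbert space on \<open>\<Omega>\<close> with kernel \<open>k\<close>. By the
  Moore--Aronszajn theorem, such a space exists for every positive semidefinite \<open>k\<close>, and
  \<open>H\<close> and the values of \<open>ip\<close> on \<open>H\<close> are determined by \<open>\<Omega>\<close> and \<open>k\<close>.\<close>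

locale rkhs = function_hilbert_space \<Omega> H ip
  for \<Omega> :: "(complex ^ 'd) set"
    and k :: "complex ^ 'd \<Rightarrow> complex ^ 'd \<Rightarrow> complex"
    and H :: "(complex ^ 'd \<Rightarrow> complex) set"
    and ip :: "(complex ^ 'd \<Rightarrow> complex) \<Rightarrow> (complex ^ 'd \<Rightarrow> complex) \<Rightarrow> complex" +
  assumes kernel_mem: "w \<in> \<Omega> \<Longrightarrow> kernel_fun \<Omega> k w \<in> H"
    and reproducing: "f \<in> H \<Longrightarrow> w \<in> \<Omega> \<Longrightarrow> f w = ip f (kernel_fun \<Omega> k w)"

text \<open>Functionals are total; only their values on \<open>H\<close> are constrained.\<close>

definition bounded_linear_functional ::
    "('a \<Rightarrow> complex) set \<Rightarrow> (('a \<Rightarrow> complex) \<Rightarrow> ('a \<Rightarrow> complex) \<Rightarrow> complex)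
      \<Rightarrow> (('a \<Rightarrow> complex) \<Rightarrow> complex) \<Rightarrow> bool" where
  "bounded_linear_functional H ip \<Lambda> \<longleftrightarrow>
     (\<forall>f\<in>H. \<forall>g\<in>H. \<Lambda> (\<lambda>z. f z + g z) = \<Lambda> f + \<Lambda> g) \<and>
     (\<forall>c. \<forall>f\<in>H. \<Lambda> (\<lambda>z. c * f z) = c * \<Lambda> f) \<and>
     (\<exists>C. \<forall>f\<in>H. cmod (\<Lambda> f) \<le> C * ip_norm ip f)"

definition multiplicative_functional ::
    "('a \<Rightarrow> complex) set \<Rightarrow> (('a \<Rightarrow> complex) \<Rightarrow> complex) \<Rightarrow> bool" where
  "multiplicative_functional H \<Lambda> \<longleftrightarrow>
     (\<forall>f\<in>H. \<forall>g\<in>H. (\<lambda>z. f z * g z) \<in> H \<longrightarrow> \<Lambda> (\<lambda>z. f z * g z) = \<Lambda> f * \<Lambda> g)"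

end

theory Submission
  imports Defs "HOL-Complex_Analysis.Conformal_Mappings"
begin

text \<open>
  The monomials \<open>z\<^sup>\<alpha>\<close> lie in \<open>H\<close> and form a total orthogonal family with \<open>\<parallel>z\<^sup>\<alpha>\<parallel>\<^sup>2 = 1 / a \<alpha>\<close>,
  so every bounded functional is the sum of its values on the monomials weighted by Taylor
  coefficients. Comparing the coefficients of \<open>cnj w\<^sup>\<gamma>\<close> in \<open>\<Lambda> (k\<^sub>w\<^sup>2) = (\<Lambda> k\<^sub>w)\<^sup>2\<close> gives
  \<open>\<Sum> a \<alpha> * a \<beta> * (\<Lambda> z\<^sup>\<gamma> - \<Lambda> z\<^sup>\<alpha> * \<Lambda> z\<^sup>\<beta>) = 0\<close>, the sum being over \<open>\<alpha> + \<beta> = \<gamma>\<close>. As the weights are positive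
  and \<open>\<Lambda> 1 = 1\<close>, induction on the degree of \<open>\<gamma>\<close> yields a point \<open>p\<close> with \<open>\<Lambda> z\<^sup>\<gamma> = p\<^sup>\<gamma>\<close>
  for all \<open>\<gamma>\<close>, and Cauchy products then give multiplicativity.

  The expansion of \<open>k\<close> is only given near the origin. It is extended to \<open>\<Omega> \<times> \<Omega>\<close> with the
  identity theorem, first for small \<open>z\<close>, which suffices to produce the monomials as norm limits of
  combinations of kernel functions; Bessel's inequality then gives convergence on \<open>\<Omega>\<close>.
\<close>

subsection \<open>Hilbert spaces of functions\<close>

context function_hilbert_space
begin

lemma diff_mem: "f \<in> H \<Longrightarrow> g \<in> H \<Longrightarrow> (\<lambda>z. f z - g z) \<in> H"
  using add_mem[OF _ scale_mem[of g "-1"], of f] by simp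

lemma sum_mem: "(\<And>i. i \<in> F \<Longrightarrow> f i \<in> H) \<Longrightarrow> (\<lambda>z. \<Sum>i\<in>F. c i * f i z) \<in> H"
proof (induction F rule: infinite_finite_induct)
  case (insert x F)
  then show ?case using add_mem[OF scale_mem[of "f x" "c x"]] by simp
qed (auto simp: zero_mem)

lemma ip_scale_right: "f \<in> H \<Longrightarrow> g \<in> H \<Longrightarrow> ip f (\<lambda>z. c * g z) = cnj c * ip f g"
  by (simp add: ip_commute[of "\<lambda>z. c * g z" f] ip_commute[of g f] ip_scale scale_mem)

lemma ip_add_right: "f \<in> H \<Longrightarrow> g \<in> H \<Longrightarrow> h \<in> H \<Longrightarrow> ip f (\<lambda>z. g z + h z) = ip f g + ip f h"
  by (simp add: ip_commute[of "\<lambda>z. g z + h z" f] ip_commute[of g f] ip_commute[of h f]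
      ip_add add_mem)

lemma ip_diff: "f \<in> H \<Longrightarrow> g \<in> H \<Longrightarrow> h \<in> H \<Longrightarrow> ip (\<lambda>z. f z - g z) h = ip f h - ip g h"
  using ip_add[OF _ scale_mem[of g "-1"], of f h] ip_scale[of g h "-1"] by simp

lemma ip_diff_right: "f \<in> H \<Longrightarrow> g \<in> H \<Longrightarrow> h \<in> H \<Longrightarrow> ip f (\<lambda>z. g z - h z) = ip f g - ip f h"
  using ip_add_right[OF _ _ scale_mem[of h "-1"], of f g] ip_scale_right[of f h "-1"] by simp

lemma ip_zero: "h \<in> H \<Longrightarrow> ip (\<lambda>z. 0) h = 0"
  using ip_scale[OF zero_mem, of h 0] by simp

lemma ip_zero_right: "h \<in> H \<Longrightarrow> ip h (\<lambda>z. 0) = 0"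
  using ip_scale_right[OF _ zero_mem, of h 0] by simp

lemma ip_sum: "(\<And>i. i \<in> F \<Longrightarrow> f i \<in> H) \<Longrightarrow> h \<in> H \<Longrightarrow>
    ip (\<lambda>z. \<Sum>i\<in>F. c i * f i z) h = (\<Sum>i\<in>F. c i * ip (f i) h)"
  by (induction F rule: infinite_finite_induct)
     (auto simp: ip_zero ip_add ip_scale scale_mem sum_mem)

lemma ip_sum_right: "(\<And>i. i \<in> F \<Longrightarrow> f i \<in> H) \<Longrightarrow> h \<in> H \<Longrightarrow>
    ip h (\<lambda>z. \<Sum>i\<in>F. c i * f i z) = (\<Sum>i\<in>F. cnj (c i) * ip h (f i))"
  by (induction F rule: infinite_finite_induct)
     (auto simp: ip_zero_right ip_add_right ip_scale_right scale_mem sum_mem)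

lemma ip_norm_nonneg: "f \<in> H \<Longrightarrow> 0 \<le> ip_norm ip f"
  by (simp add: ip_norm_def ip_nonneg)

lemma ip_self: "f \<in> H \<Longrightarrow> ip f f = of_real ((ip_norm ip f)\<^sup>2)"
  using ip_commute[of f f] ip_nonneg[of f] by (auto simp: ip_norm_def complex_eq_iff)

lemma ip_norm_eq_0_iff: "f \<in> H \<Longrightarrow> ip_norm ip f = 0 \<longleftrightarrow> f = (\<lambda>z. 0)"
  by (metis ip_definite ip_self ip_zero of_real_0 of_real_eq_0_iff power_eq_0_iff
      zero_power2)

lemma ip_norm_minus_commute:
  assumes "f \<in> H" "g \<in> H"
  shows "ip_norm ip (\<lambda>z. f z - g z) = ip_norm ip (\<lambda>z. g z - f z)"
proof -
  have "ip (\<lambda>z. f z - g z) (\<lambda>z. f z - g z) = ip (\<lambda>z. g z - f z) (\<lambda>z. g z - f z)"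
    using assms by (simp add: ip_diff ip_diff_right diff_mem)
  then show ?thesis by (simp add: ip_norm_def)
qed

lemma Cauchy_Schwarz:
  assumes f: "f \<in> H" and g: "g \<in> H"
  shows "cmod (ip f g) \<le> ip_norm ip f * ip_norm ip g"
proof (cases "ip_norm ip g = 0")
  case True
  then show ?thesis using f g by (simp add: ip_norm_eq_0_iff ip_zero_right ip_norm_def[of ip "\<lambda>z. 0"] zero_mem)
next
  case False
  define n where "n = (ip_norm ip g)\<^sup>2"
  have n: "n > 0" using False by (simp add: n_def)
  \<comment> \<open>With this \<open>c\<close> the vector \<open>c * g\<close> is the orthogonal
    projection of \<open>f\<close> onto the line of \<open>g\<close>; the inequality is the
    nonnegativity of the squared norm of the remainder \<open>?h\<close>.\<close>
  define c where "c = ip f g / of_real n"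
  let ?h = "\<lambda>z. f z - c * g z"
  have cg: "(\<lambda>z. c * g z) \<in> H" using g by (rule scale_mem)
  have h: "?h \<in> H" using f cg by (rule diff_mem)
  have "ip ?h ?h = ip f f - cnj c * ip f g - c * cnj (ip f g) + c * cnj c * ip g g"
    using f g cg h
    by (simp add: ip_diff ip_diff_right ip_scale ip_scale_right ip_commute[of f g] algebra_simps)
  also have "\<dots> = of_real ((ip_norm ip f)\<^sup>2 - (cmod (ip f g))\<^sup>2 / n)"
    using n unfolding ip_self[OF f] ip_self[OF g] n_def[symmetric] c_def
    by (simp add: field_simps complex_norm_square[symmetric] flip: of_real_power)
  finally have "0 \<le> (ip_norm ip f)\<^sup>2 - (cmod (ip f g))\<^sup>2 / n"
    using ip_nonneg[OF h] by simp
  then have "(cmod (ip f g))\<^sup>2 \<le> (ip_norm ip f * ip_norm ip g)\<^sup>2"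
    using n by (simp add: field_simps n_def power_mult_distrib)
  then show ?thesis
    by (rule power2_le_imp_le) (simp add: f g ip_norm_nonneg)
qed

lemma ip_tendsto:
  assumes X: "\<And>n. X n \<in> H" "f \<in> H" "g \<in> H"
    and lim: "(\<lambda>n. ip_norm ip (\<lambda>z. X n z - f z)) \<longlonglongrightarrow> 0"
  shows "(\<lambda>n. ip (X n) g) \<longlonglongrightarrow> ip f g"
proof -
  have "(\<lambda>n. ip_norm ip (\<lambda>z. X n z - f z) * ip_norm ip g) \<longlonglongrightarrow> 0"
    using tendsto_mult_right[OF lim, of "ip_norm ip g"] by simp
  then have "(\<lambda>n. ip (X n) g - ip f g) \<longlonglongrightarrow> 0"
  proof (rule Lim_null_comparison[rotated], intro always_eventually allI)
    fix n
    show "norm (ip (X n) g - ip f g) \<le> ip_norm ip (\<lambda>z. X n z - f z) * ip_norm ip g"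
      using Cauchy_Schwarz[OF diff_mem[OF X(1,2)] X(3)] X by (simp add: ip_diff)
  qed
  then show ?thesis by (simp add: LIM_zero_iff)
qed

end

section \<open>Orthogonal families: projections, Bessel's inequality and expansions of
  functionals\<close>

locale orthogonal_family = function_hilbert_space +
  fixes e :: "'i \<Rightarrow> complex ^ 'a \<Rightarrow> complex" and a :: "'i \<Rightarrow> real"
  assumes e_mem: "e i \<in> H"
    and a_pos: "a i > 0"
    and ip_e: "ip (e i) (e j) = (if i = j then of_real (inverse (a i)) else 0)"
begin

text \<open>Multiplying by \<open>a i\<close> divides by the squared norm of \<open>e i\<close>, so
  this is the Fourier coefficient for a family left unnormalised. For the monomials it will be the
  Taylor coefficient.\<close>

definition coef where "coef f i = of_real (a i) * ip f (e i)"

definition psum where "psum f F = (\<lambda>z. \<Sum>i\<in>F. coef f i * e i z)"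

lemma psum_mem: "psum f F \<in> H"
  unfolding psum_def by (rule sum_mem) (rule e_mem)

lemma ip_psum: "finite F \<Longrightarrow> ip (psum f F) (e i) = (if i \<in> F then ip f (e i) else 0)"
  using a_pos[of i] unfolding psum_def
  by (subst ip_sum) (auto simp: e_mem ip_e coef_def if_distrib cong: if_cong)

text \<open>Pythagoras: \<open>psum f F\<close> is the orthogonal projection of \<open>f\<close>
  onto the span of the \<open>e i\<close> with \<open>i\<close> in \<open>F\<close>, so the mixed
  inner products and the squared norm of the projection are all the same number
  \<open>?S\<close>.\<close>

lemma norm_diff_psum:
  assumes "f \<in> H" "finite F"
  shows "(ip_norm ip (\<lambda>z. f z - psum f F z))\<^sup>2
    = (ip_norm ip f)\<^sup>2 - (\<Sum>i\<in>F. a i * (cmod (ip f (e i)))\<^sup>2)"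
proof -
  let ?S = "of_real (\<Sum>i\<in>F. a i * (cmod (ip f (e i)))\<^sup>2) :: complex"
  have 1: "ip f (psum f F) = ?S"
    unfolding psum_def
    by (subst ip_sum_right) (auto simp: e_mem assms coef_def complex_norm_square algebra_simps simp del: of_real_power)
  then have 2: "ip (psum f F) f = ?S"
    using assms by (simp add: ip_commute[of f "psum f F"] psum_mem del: of_real_sum)
  have "ip (psum f F) (psum f F) = (\<Sum>i\<in>F. cnj (coef f i) * ip (psum f F) (e i))"
    using ip_sum_right[of F e "psum f F" "coef f"] by (simp add: e_mem psum_mem flip: psum_def)
  also have "\<dots> = ip f (psum f F)"
    unfolding psum_def[of f F] using assms
    by (subst ip_sum_right) (auto simp: e_mem ip_psum psum_def[symmetric])
  finally have 3: "ip (psum f F) (psum f F) = ?S" using 1 by simp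
  have "of_real ((ip_norm ip (\<lambda>z. f z - psum f F z))\<^sup>2) = ip f f - ?S"
    using assms psum_mem 1 2 3
    by (subst ip_self[symmetric]) (simp_all add: diff_mem ip_diff ip_diff_right del: of_real_sum)
  also have "\<dots> = of_real ((ip_norm ip f)\<^sup>2 - (\<Sum>i\<in>F. a i * (cmod (ip f (e i)))\<^sup>2))"
    using assms by (simp add: ip_self)
  finally show ?thesis unfolding of_real_eq_iff .
qed

lemma Bessel:
  assumes "f \<in> H" "finite F"
  shows "(\<Sum>i\<in>F. a i * (cmod (ip f (e i)))\<^sup>2) \<le> (ip_norm ip f)\<^sup>2"
  using norm_diff_psum[OF assms] zero_le_power2[of "ip_norm ip (\<lambda>z. f z - psum f F z)"] by linarith

text \<open>Enlarging the index set subtracts further nonnegative terms in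
  \<open>norm_diff_psum\<close>. This lets one good finite set control all finite supersets, which
  turns convergence along a sequence into unordered summation.\<close>

lemma norm_diff_psum_antimono:
  assumes f: "f \<in> H" and F: "finite G" "F \<subseteq> G"
  shows "ip_norm ip (\<lambda>z. f z - psum f G z) \<le> ip_norm ip (\<lambda>z. f z - psum f F z)"
proof (rule power2_le_imp_le)
  have "finite F" using F finite_subset by blast
  moreover have "(\<Sum>i\<in>F. a i * (cmod (ip f (e i)))\<^sup>2) \<le> (\<Sum>i\<in>G. a i * (cmod (ip f (e i)))\<^sup>2)"
    using F by (intro sum_mono2) (auto simp: a_pos less_imp_le)
  ultimately show "(ip_norm ip (\<lambda>z. f z - psum f G z))\<^sup>2 \<le> (ip_norm ip (\<lambda>z. f z - psum f F z))\<^sup>2"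
    using f F by (simp add: norm_diff_psum)
qed (simp add: diff_mem f ip_norm_nonneg psum_mem)

lemma psum_psum:
  assumes "finite G" "F \<subseteq> G"
  shows "psum (psum f G) F = psum f F"
  unfolding psum_def[of _ F] coef_def using assms by (auto simp: ip_psum intro!: ext sum.cong)

text \<open>Squared distances between nested projections are differences of partial sums of the
  Bessel series, and these partial sums are increasing and bounded.\<close>

lemma Cauchy_psum:
  fixes A :: "nat \<Rightarrow> 'i set"
  assumes f: "f \<in> H" and A: "\<And>n. finite (A n)" "mono A"
    and \<epsilon>: "\<epsilon> > 0"
  shows "\<exists>N. \<forall>m\<ge>N. \<forall>n\<ge>N. ip_norm ip (\<lambda>z. psum f (A m) z - psum f (A n) z) < \<epsilon>"
proof -
  let ?s = "\<lambda>n. \<Sum>i\<in>A n. a i * (cmod (ip f (e i)))\<^sup>2"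
  have "convergent ?s"
  proof (rule Bseq_mono_convergent)
    show "Bseq ?s"
      using Bessel[OF f A(1)] by (intro BseqI'[of _ "(ip_norm ip f)\<^sup>2"]) (simp add: a_pos sum_nonneg less_imp_le)
    show "\<forall>m. \<forall>n\<ge>m. ?s m \<le> ?s n"
      using A by (intro allI impI sum_mono2) (auto simp: a_pos less_imp_le dest: monoD)
  qed
  then have "Cauchy ?s" by (simp add: convergent_Cauchy)
  then obtain N where N: "\<And>m n. m \<ge> N \<Longrightarrow> n \<ge> N \<Longrightarrow> dist (?s m) (?s n) < \<epsilon>\<^sup>2"
    using \<epsilon> unfolding Cauchy_def by (meson zero_less_power)
  have norm: "(ip_norm ip (\<lambda>z. psum f (A m) z - psum f (A n) z))\<^sup>2 = ?s m - ?s n" if "n \<le> m" for m n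
  proof -
    have sub: "A n \<subseteq> A m" using A(2) that by (auto dest: monoD)
    have "(ip_norm ip (psum f (A m)))\<^sup>2 = ?s m"
    proof -
      \<comment> \<open>The vector \<open>psum f (A m)\<close> is its own projection, so
        \<open>norm_diff_psum\<close> with left side zero yields its norm.\<close>
      have "(ip_norm ip (\<lambda>z. psum f (A m) z - psum (psum f (A m)) (A m) z))\<^sup>2 = 0"
        by (simp add: psum_psum A ip_norm_eq_0_iff zero_mem)
      then show ?thesis
        by (simp add: norm_diff_psum psum_mem A ip_psum)
    qed
    moreover have "(ip_norm ip (\<lambda>z. psum f (A m) z - psum (psum f (A m)) (A n) z))\<^sup>2
        = (ip_norm ip (psum f (A m)))\<^sup>2 - ?s n"
      using sub by (subst norm_diff_psum) (auto simp: psum_mem A ip_psum intro!: sum.cong)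
    ultimately show ?thesis by (simp add: psum_psum A sub)
  qed
  have "ip_norm ip (\<lambda>z. psum f (A m) z - psum f (A n) z) < \<epsilon>" if "m \<ge> N" "n \<ge> N" for m n
  proof -
    have *: "ip_norm ip (\<lambda>z. psum f (A m) z - psum f (A n) z) < \<epsilon>" if "n \<le> m" "m \<ge> N" "n \<ge> N" for m n
    proof (rule power2_less_imp_less)
      show "(ip_norm ip (\<lambda>z. psum f (A m) z - psum f (A n) z))\<^sup>2 < \<epsilon>\<^sup>2"
        using N[of m n] that by (simp add: norm dist_real_def)
    qed (use \<epsilon> in simp)
    show ?thesis
    proof (cases "n \<le> m")
      case False
      then have "ip_norm ip (\<lambda>z. psum f (A n) z - psum f (A m) z) < \<epsilon>"
        using *[of m n] that by simp
      then show ?thesis using ip_norm_minus_commute[OF psum_mem psum_mem, of f "A m" f "A n"] by simp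
    qed (use * that in blast)
  qed
  then show ?thesis by blast
qed

text \<open>The projections along the exhaustion \<open>A\<close> converge to some \<open>g\<close>
  by completeness. As \<open>f - g\<close> is orthogonal to every \<open>e i\<close>, totality gives
  \<open>g = f\<close>, and boundedness of \<open>L\<close> carries the norm convergence over to the
  values of \<open>L\<close>.\<close>

lemma orthogonal_expansion:
  fixes A :: "nat \<Rightarrow> 'i set"
  assumes total: "\<And>h. h \<in> H \<Longrightarrow> (\<And>i. ip h (e i) = 0) \<Longrightarrow> h = (\<lambda>z. 0)"
    and A: "\<And>n. finite (A n)" "mono A" "\<And>i. \<exists>n. i \<in> A n"
    and f: "f \<in> H" and L: "bounded_linear_functional H ip L"
  shows "((\<lambda>i. coef f i * L (e i)) has_sum L f) UNIV"
proof -
  have "\<exists>g\<in>H. (\<lambda>n. ip_norm ip (\<lambda>z. psum f (A n) z - g z)) \<longlonglongrightarrow> 0"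
    by (rule complete[OF psum_mem Cauchy_psum[OF f A(1,2)]])
  then obtain g where g: "g \<in> H" "(\<lambda>n. ip_norm ip (\<lambda>z. psum f (A n) z - g z)) \<longlonglongrightarrow> 0"
    by blast
  have "(\<lambda>z. f z - g z) = (\<lambda>z. 0)"
  proof (rule total)
    fix i
    have "(\<lambda>n. ip (psum f (A n)) (e i)) \<longlonglongrightarrow> ip g (e i)"
      by (rule ip_tendsto) (use g psum_mem e_mem in auto)
    moreover obtain n where "i \<in> A n" using A(3) by blast
    then have "eventually (\<lambda>n. ip (psum f (A n)) (e i) = ip f (e i)) sequentially"
      using A(1,2) by (intro eventually_sequentiallyI[of n]) (auto simp: ip_psum dest: monoD)
    ultimately have "ip g (e i) = ip f (e i)"
      by (rule LIMSEQ_unique[OF _ tendsto_eventually])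
    then show "ip (\<lambda>z. f z - g z) (e i) = 0" using f g e_mem by (simp add: ip_diff)
  qed (use f g in \<open>auto intro: diff_mem\<close>)
  then have "g = f" by (auto simp: fun_eq_iff)
  obtain C where C: "\<And>f. f \<in> H \<Longrightarrow> cmod (L f) \<le> C * ip_norm ip f"
    using L unfolding bounded_linear_functional_def by blast
  have L_add: "L (\<lambda>z. f z + g z) = L f + L g" if "f \<in> H" "g \<in> H" for f g
    using L that unfolding bounded_linear_functional_def by blast
  have L_scale: "L (\<lambda>z. c * f z) = c * L f" if "f \<in> H" for f c
    using L that unfolding bounded_linear_functional_def by blast
  have L_psum: "L (psum f F) = (\<Sum>i\<in>F. coef f i * L (e i))" if "finite F" for F
    using that unfolding psum_def
  proof (induction F rule: finite_induct)
    case empty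
    then show ?case using L_scale[OF zero_mem, of 0] by simp
  next
    case (insert x F)
    then show ?case by (simp add: L_add L_scale scale_mem sum_mem e_mem)
  qed
  show ?thesis
    unfolding has_sum_def tendsto_iff eventually_finite_subsets_at_top
  proof (intro allI impI)
    fix \<epsilon> :: real assume \<epsilon>: "\<epsilon> > 0"
    \<comment> \<open>The bound \<open>C\<close> may be zero or negative, while the tolerance is
      divided by \<open>D\<close>.\<close>
    define D where "D = \<bar>C\<bar> + 1"
    have D: "D > 0" "C \<le> D" by (auto simp: D_def)
    obtain n where n: "ip_norm ip (\<lambda>z. psum f (A n) z - f z) < \<epsilon> / D"
      using order_tendstoD(2)[OF g(2), of "\<epsilon> / D"] \<epsilon> D unfolding \<open>g = f\<close> eventually_sequentially by auto
    have n': "ip_norm ip (\<lambda>z. f z - psum f (A n) z) < \<epsilon> / D"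
      using n ip_norm_minus_commute[OF f psum_mem[of f "A n"]] by simp
    have "dist (\<Sum>i\<in>F. coef f i * L (e i)) (L f) < \<epsilon>" if F: "finite F" "A n \<subseteq> F" for F
    proof -
      have "L f - L (psum f F) = L (\<lambda>z. f z - psum f F z)"
        using L_add[OF f scale_mem[OF psum_mem[of f F], of "-1"]] L_scale[OF psum_mem[of f F], of "-1"] by simp
      then have "dist (L (psum f F)) (L f) = cmod (L (\<lambda>z. f z - psum f F z))"
        by (simp add: dist_norm norm_minus_commute)
      also have "\<dots> \<le> C * ip_norm ip (\<lambda>z. f z - psum f F z)"
        by (intro C diff_mem f psum_mem)
      also have "\<dots> \<le> D * ip_norm ip (\<lambda>z. f z - psum f F z)"
        using D by (intro mult_right_mono ip_norm_nonneg diff_mem f psum_mem)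
      also have "\<dots> \<le> D * ip_norm ip (\<lambda>z. f z - psum f (A n) z)"
        using D F f by (intro mult_left_mono norm_diff_psum_antimono) auto
      also have "\<dots> < \<epsilon>" using n' D by (simp add: field_simps)
      finally show ?thesis by (simp add: L_psum F)
    qed
    then show "\<exists>X. finite X \<and> X \<subseteq> UNIV \<and> (\<forall>Y. finite Y \<and> X \<subseteq> Y \<and> Y \<subseteq> UNIV \<longrightarrow>
        dist (\<Sum>i\<in>Y. coef f i * L (e i)) (L f) < \<epsilon>)"
      using A(1) by blast
  qed
qed

end

subsection \<open>Multi-indices and power series\<close>

definition multi_degree :: "nat ^ 'd \<Rightarrow> nat" where
  "multi_degree \<alpha> = (\<Sum>i\<in>UNIV. \<alpha> $ i)"

lemma multi_power_0 [simp]: "multi_power z 0 = 1"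
  by (simp add: multi_power_def)

lemma multi_power_add: "multi_power z (\<alpha> + \<beta>) = multi_power z \<alpha> * multi_power z \<beta>"
  by (simp add: multi_power_def power_add prod.distrib)

lemma multi_power_scale: "multi_power (c *s z) \<alpha> = c ^ multi_degree \<alpha> * multi_power z \<alpha>"
  by (simp add: multi_power_def multi_degree_def power_mult_distrib prod.distrib power_sum)

lemma multi_power_axis: "multi_power z (axis i 1) = z $ i"
proof -
  have "(z $ j) ^ (axis i 1 $ j :: nat) = (if j = i then z $ j else 1)" for j
    by (simp add: axis_def)
  then show ?thesis by (simp add: multi_power_def)
qed

lemma multi_power_mult:
  "multi_power (\<chi> i. z $ i * w $ i) \<alpha> = multi_power z \<alpha> * multi_power w \<alpha>"
  by (simp add: multi_power_def power_mult_distrib prod.distrib)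

lemma multi_power_cnj: "multi_power (\<chi> i. cnj (z $ i)) \<alpha> = cnj (multi_power z \<alpha>)"
  by (simp add: multi_power_def)

lemma norm_multi_power_le:
  assumes "\<And>i. cmod (z $ i) \<le> cmod (w $ i)"
  shows "cmod (multi_power z \<alpha>) \<le> cmod (multi_power w \<alpha>)"
  unfolding multi_power_def prod_norm[symmetric] norm_power
  by (intro prod_mono conjI power_mono assms) auto

lemma multi_degree_add: "multi_degree (\<alpha> + \<beta>) = multi_degree \<alpha> + multi_degree \<beta>"
  by (simp add: multi_degree_def sum.distrib)

lemma multi_degree_eq_0_iff: "multi_degree \<alpha> = 0 \<longleftrightarrow> \<alpha> = 0"
  by (auto simp: multi_degree_def vec_eq_iff)

lemma multi_degree_eq_1:
  assumes "multi_degree \<alpha> = 1"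
  obtains i where "\<alpha> = axis i 1"
proof -
  obtain i where i: "\<alpha> $ i = 1" "\<And>j. j \<noteq> i \<Longrightarrow> \<alpha> $ j = 0"
    using assms sum_eq_Suc0_iff[of UNIV "vec_nth \<alpha>"] by (auto simp: multi_degree_def)
  then have "\<alpha> = axis i 1" by (auto simp: vec_eq_iff axis_def)
  then show ?thesis by (rule that)
qed

lemma finite_multi_index_box: "finite {\<alpha> :: nat ^ 'd. \<forall>i. \<alpha> $ i \<le> n i}"
proof (rule finite_imageD)
  have "vec_nth ` {\<alpha> :: nat ^ 'd. \<forall>i. \<alpha> $ i \<le> n i} \<subseteq> PiE UNIV (\<lambda>i. {..n i})"
    by auto
  then show "finite (vec_nth ` {\<alpha> :: nat ^ 'd. \<forall>i. \<alpha> $ i \<le> n i})"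
    by (rule finite_subset) (auto intro: finite_PiE)
qed (auto simp: inj_on_def vec_eq_iff)

definition splittings :: "nat ^ 'd \<Rightarrow> ((nat ^ 'd) \<times> (nat ^ 'd)) set" where
  "splittings \<gamma> = {p. fst p + snd p = \<gamma>}"

lemma finite_splittings: "finite (splittings \<gamma>)"
proof -
  let ?B = "{\<alpha>. \<forall>i. \<alpha> $ i \<le> \<gamma> $ i}"
  have "splittings \<gamma> \<subseteq> ?B \<times> ?B" by (auto simp: splittings_def)
  then show ?thesis
    using finite_multi_index_box[of "\<lambda>i. \<gamma> $ i"] by (meson finite_SigmaI finite_subset)
qed

text \<open>Unordered convergence over the complex numbers is absolute, so the double series is
  summable. It may then be regrouped along the fibres of addition, which are the finite sets
  \<open>splittings \<gamma>\<close>.\<close>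

lemma Cauchy_product_multi:
  fixes x y :: "nat ^ 'd \<Rightarrow> complex"
  assumes x: "(x has_sum X) UNIV" and y: "(y has_sum Y) UNIV"
  shows "((\<lambda>\<gamma>. \<Sum>p\<in>splittings \<gamma>. x (fst p) * y (snd p)) has_sum X * Y) UNIV"
proof -
  let ?f = "\<lambda>p. x (fst p) * y (snd p)"
  have nx: "(\<lambda>\<alpha>. cmod (x \<alpha>)) summable_on UNIV" and ny: "(\<lambda>\<alpha>. cmod (y \<alpha>)) summable_on UNIV"
    using x y summable_on_iff_abs_summable_on_complex by (auto simp: summable_on_def)
  have "(\<lambda>p. cmod (?f p)) summable_on UNIV \<times> UNIV"
  proof (rule summable_on_SigmaI)
    show "((\<lambda>\<beta>. cmod (?f (\<alpha>, \<beta>))) has_sum (cmod (x \<alpha>) * (\<Sum>\<^sub>\<infinity>\<beta>. cmod (y \<beta>)))) UNIV" for \<alpha>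
      using has_sum_cmult_right[OF has_sum_infsum[OF ny]] by (simp add: norm_mult)
    show "(\<lambda>\<alpha>. cmod (x \<alpha>) * (\<Sum>\<^sub>\<infinity>\<beta>. cmod (y \<beta>))) summable_on UNIV"
      by (rule summable_on_cmult_left[OF nx])
  qed simp
  then have "?f summable_on UNIV \<times> UNIV" by (rule abs_summable_summable)
  then have "(?f has_sum X * Y) (UNIV \<times> UNIV)"
    by (intro has_sum_SigmaI[where g = "\<lambda>\<alpha>. x \<alpha> * Y"])
       (auto intro: has_sum_cmult_left has_sum_cmult_right x y)
  also have "?this \<longleftrightarrow> ((\<lambda>q. ?f (snd q)) has_sum X * Y) (Sigma UNIV splittings)"
    by (rule has_sum_reindex_bij_witness[where i = snd and j = "\<lambda>p. (fst p + snd p, p)"])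
       (auto simp: splittings_def)
  finally show ?thesis
    by (rule has_sum_SigmaD) (auto intro: has_sum_finite finite_splittings)
qed

section \<open>Power series on polydiscs: products and absolute convergence\<close>

definition polydisc :: "real \<Rightarrow> (complex ^ 'd) set" where
  "polydisc r = {z. \<forall>i. cmod (z $ i) < r}"

definition expands :: "(complex ^ 'd \<Rightarrow> complex) \<Rightarrow> (nat ^ 'd \<Rightarrow> complex) \<Rightarrow> real \<Rightarrow> bool" where
  "expands f c r \<longleftrightarrow> (\<forall>z\<in>polydisc r. ((\<lambda>\<alpha>. c \<alpha> * multi_power z \<alpha>) has_sum f z) UNIV)"

lemma has_sum_minus:
  fixes f g :: "'i \<Rightarrow> complex"
  assumes "(f has_sum a) A" "(g has_sum b) A"
  shows "((\<lambda>x. f x - g x) has_sum (a - b)) A"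
  using has_sum_add[OF assms(1) has_sum_uminusI[OF assms(2)]] by simp

lemma expands_mult:
  assumes "expands f c r" "expands g b r"
  shows "expands (\<lambda>z. f z * g z) (\<lambda>\<gamma>. \<Sum>p\<in>splittings \<gamma>. c (fst p) * b (snd p)) r"
  unfolding expands_def
proof
  fix z :: "complex ^ 'a" assume z: "z \<in> polydisc r"
  have "(\<Sum>p\<in>splittings \<gamma>. (c (fst p) * multi_power z (fst p)) * (b (snd p) * multi_power z (snd p)))
      = (\<Sum>p\<in>splittings \<gamma>. c (fst p) * b (snd p)) * multi_power z \<gamma>" for \<gamma>
    unfolding sum_distrib_right
    by (rule sum.cong) (auto simp: splittings_def multi_power_add)
  then show "((\<lambda>\<gamma>. (\<Sum>p\<in>splittings \<gamma>. c (fst p) * b (snd p)) * multi_power z \<gamma>) has_sum f z * g z) UNIV"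
    using Cauchy_product_multi[of "\<lambda>\<alpha>. c \<alpha> * multi_power z \<alpha>" "f z" "\<lambda>\<alpha>. b \<alpha> * multi_power z \<alpha>" "g z"]
      assms z by (simp add: expands_def)
qed

lemma expands_summable_norm:
  assumes "expands f c r" "0 < \<rho>" "\<rho> < r"
  shows "(\<lambda>\<beta>. cmod (c \<beta>) * \<rho> ^ multi_degree \<beta>) summable_on UNIV"
proof -
  \<comment> \<open>At the point with all coordinates \<rho>, the modulus of the \<beta>-th power is
    exactly \<open>\<rho> ^ multi_degree \<beta>\<close>.\<close>
  define z :: "complex ^ 'a" where "z = complex_of_real \<rho> *s 1"
  have "z \<in> polydisc r" using assms by (simp add: z_def polydisc_def)
  then have "(\<lambda>\<beta>. cmod (c \<beta> * multi_power z \<beta>)) summable_on UNIV"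
    using assms(1) unfolding expands_def summable_on_iff_abs_summable_on_complex[symmetric]
    by (meson has_sum_imp_summable)
  moreover have "cmod (c \<beta> * multi_power z \<beta>) = cmod (c \<beta>) * \<rho> ^ multi_degree \<beta>" for \<beta>
    using assms(2) unfolding z_def multi_power_scale
    by (simp add: norm_mult norm_power multi_power_def)
  ultimately show ?thesis by simp
qed

subsection \<open>Extracting Taylor coefficients with finitely many evaluations\<close>

text \<open>A discrete Cauchy formula: the nodes are the roots of unity of order
  \<open>n + 1\<close>, and the weights \<open>t j / (n + 1)\<close> make the m-th moment the
  average of the powers \<open>t j ^ (m + 1)\<close>. It is 1 if \<open>n + 1\<close> divides
  \<open>m + 1\<close> and 0 otherwise, so among \<open>m \<le> n\<close> only \<open>m = n\<close>
  survives.\<close>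

lemma moment_nodes:
  obtains u t :: "nat \<Rightarrow> complex"
  where "\<And>j. cmod (t j) \<le> 1" "(\<Sum>j\<le>n. u j * t j ^ n) = 1"
    "\<And>m. m < n \<Longrightarrow> (\<Sum>j\<le>n. u j * t j ^ m) = 0" "\<And>m. cmod (\<Sum>j\<le>n. u j * t j ^ m) \<le> 1"
proof -
  define N where "N = Suc n"
  define t where "t j = exp (2 * of_real pi * \<i> * of_nat j / of_nat N)" for j
  define u where "u j = t j / of_nat N" for j
  have norm_t: "cmod (t j) = 1" for j by (simp add: t_def norm_exp_eq_Re)
  have sum: "(\<Sum>j\<le>n. u j * t j ^ m) = (\<Sum>j<N. t (Suc m) ^ j) / of_nat N" for m
  proof -
    have "u j * t j ^ m = t (Suc m) ^ j / of_nat N" for j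
    proof -
      have "t j ^ Suc m = t (Suc m) ^ j"
        unfolding t_def exp_of_nat_mult[symmetric] by (simp add: algebra_simps)
      then show ?thesis by (simp add: u_def)
    qed
    then show ?thesis by (simp add: sum_divide_distrib N_def lessThan_Suc_atMost)
  qed
  show ?thesis
  proof (rule that[of t u])
    have "t (Suc n) = 1"
      using complex_root_unity_eq_1[of N "Suc n"] by (simp add: t_def N_def)
    then show "(\<Sum>j\<le>n. u j * t j ^ n) = 1" by (simp add: sum N_def del: of_nat_Suc)
  next
    fix m assume "m < n"
    then have "\<not> N dvd Suc m" unfolding N_def using nat_dvd_not_less[of "Suc m" "Suc n"] by simp
    then have "t (Suc m) \<noteq> 1"
      using complex_root_unity_eq_1[of N "Suc m"] by (simp add: t_def N_def del: of_nat_Suc)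
    moreover have "t (Suc m) ^ N = 1"
      unfolding t_def by (rule complex_root_unity) (simp add: N_def)
    ultimately show "(\<Sum>j\<le>n. u j * t j ^ m) = 0"
      by (simp add: sum geometric_sum)
  next
    fix m
    have "cmod (\<Sum>j<N. t (Suc m) ^ j) \<le> (\<Sum>j<N. 1)"
      by (rule sum_norm_le) (simp add: norm_power norm_t)
    then show "cmod (\<Sum>j\<le>n. u j * t j ^ m) \<le> 1"
      unfolding sum norm_divide norm_of_nat by (simp add: N_def del: of_nat_Suc)
  qed (simp add: norm_t)
qed

text \<open>A finite-difference functional that isolates the \<alpha>-th Taylor coefficient;
  \<open>\<mu> \<beta>\<close> is its value on the \<beta>-th monomial. Degrees above that of
  \<alpha> are only bounded, because shrinking the nodes suppresses them.\<close>

locale taylor_nodes =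
  fixes \<alpha> :: "nat ^ 'd" and J :: "'j set" and U :: "'j \<Rightarrow> complex" and T :: "'j \<Rightarrow> complex ^ 'd"
    and \<mu> :: "nat ^ 'd \<Rightarrow> complex"
  assumes finite_J: "finite J"
    and nodes_le: "cmod (T j $ i) \<le> 1"
    and \<mu>_eq: "\<mu> \<beta> = (\<Sum>j\<in>J. U j * multi_power (T j) \<beta>)"
    and \<mu>_self: "\<mu> \<alpha> = 1"
    and \<mu>_eq_0: "\<beta> \<noteq> \<alpha> \<Longrightarrow> multi_degree \<beta> \<le> multi_degree \<alpha> \<Longrightarrow> \<mu> \<beta> = 0"
    and norm_\<mu>: "cmod (\<mu> \<beta>) \<le> 1"

text \<open>Tensor product of the one-variable nodes of order \<open>\<alpha> $ i\<close> in
  coordinate \<open>i\<close>, so that \<open>\<mu>\<close> factorises over the coordinates. If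
  \<beta> differs from \<alpha> without exceeding its degree, then some
  \<open>\<beta> $ i < \<alpha> $ i\<close>, and the factor for \<open>i\<close> vanishes.\<close>

lemma taylor_nodes_exist:
  fixes \<alpha> :: "nat ^ 'd"
  obtains J :: "('d \<Rightarrow> nat) set" and U T \<mu> where "taylor_nodes \<alpha> J U T \<mu>"
proof -
  define P where "P n u t \<longleftrightarrow> (\<forall>j. cmod (t j) \<le> 1) \<and> (\<Sum>j\<le>n. u j * t j ^ n) = 1 \<and>
      (\<forall>m<n. (\<Sum>j\<le>n. u j * t j ^ m) = 0) \<and> (\<forall>m. cmod (\<Sum>j\<le>n. u j * t j ^ m) \<le> 1)"
    for n and u t :: "nat \<Rightarrow> complex"
  have "\<forall>n. \<exists>u t. P n u t"
  proof
    fix n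
    show "\<exists>u t. P n u t"
      by (rule moment_nodes[of n]) (auto simp: P_def)
  qed
  then obtain u t where "\<And>n. P n (u n) (t n)" by metis
  then have ut:
      "\<And>n j. cmod (t n j) \<le> 1" "\<And>n. (\<Sum>j\<le>n. u n j * t n j ^ n) = 1"
      "\<And>n m. m < n \<Longrightarrow> (\<Sum>j\<le>n. u n j * t n j ^ m) = 0" "\<And>n m. cmod (\<Sum>j\<le>n. u n j * t n j ^ m) \<le> 1"
    unfolding P_def by blast+
  define J where "J = PiE (UNIV :: 'd set) (\<lambda>i. {..\<alpha> $ i})"
  define U where "U j = (\<Prod>i\<in>UNIV. u (\<alpha> $ i) (j i))" for j
  define T :: "('d \<Rightarrow> nat) \<Rightarrow> complex ^ 'd" where "T j = (\<chi> i. t (\<alpha> $ i) (j i))" for j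
  define \<mu> where "\<mu> \<beta> = (\<Sum>j\<in>J. U j * multi_power (T j) \<beta>)" for \<beta>
  have \<mu>: "\<mu> \<beta> = (\<Prod>i\<in>UNIV. \<Sum>k\<le>\<alpha> $ i. u (\<alpha> $ i) k * t (\<alpha> $ i) k ^ (\<beta> $ i))" for \<beta>
    unfolding \<mu>_def J_def by (subst prod_sum_PiE) (auto simp: U_def T_def multi_power_def prod.distrib)
  have "taylor_nodes \<alpha> J U T \<mu>"
  proof
    show "finite J" by (auto simp: J_def intro: finite_PiE)
    show "\<mu> \<beta> = 0" if ne: "\<beta> \<noteq> \<alpha>" and deg: "multi_degree \<beta> \<le> multi_degree \<alpha>" for \<beta>
    proof -
      have "\<exists>i. \<beta> $ i < \<alpha> $ i"
      proof (rule ccontr)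
        assume "\<not> ?thesis"
        then have le: "\<alpha> $ i \<le> \<beta> $ i" for i by (simp add: not_less)
        obtain k where "\<alpha> $ k \<noteq> \<beta> $ k" using ne by (metis vec_eq_iff)
        then have "multi_degree \<alpha> < multi_degree \<beta>"
          unfolding multi_degree_def using le
          by (intro sum_strict_mono_ex1) (auto intro!: exI[of _ k] simp: le_neq_implies_less)
        then show False using deg by simp
      qed
      then show ?thesis unfolding \<mu> using ut(3) by (intro prod_zero) auto
    qed
    show "cmod (\<mu> \<beta>) \<le> 1" for \<beta>
      unfolding \<mu> prod_norm[symmetric] by (intro prod_le_1 conjI ut norm_ge_zero)
    show "\<mu> \<beta> = (\<Sum>j\<in>J. U j * multi_power (T j) \<beta>)" for \<beta>
      by (rule \<mu>_def)
  qed (auto simp: T_def \<mu> ut)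
  then show ?thesis by (rule that)
qed

lemma has_sum_finite_sum:
  fixes s :: "'j \<Rightarrow> complex"
  assumes "finite J" "\<And>j. j \<in> J \<Longrightarrow> (f j has_sum s j) A"
  shows "((\<lambda>x. \<Sum>j\<in>J. f j x) has_sum (\<Sum>j\<in>J. s j)) A"
  using assms
proof (induction J rule: finite_induct)
  case (insert j J)
  then show ?case using has_sum_add[where f = "f j" and a = "s j"] by simp
qed simp

text \<open>Division by the power of \<rho> belonging to \<alpha> leaves \<open>x \<alpha>\<close>
  plus terms of strictly larger degree. Each of these has a spare factor \<rho>, and what remains is
  dominated by the absolutely convergent series at \<sigma>. The resulting constant depends neither
  on \<rho> nor on \<open>s\<close>.\<close>

lemma leading_coefficient_bound:
  fixes x :: "nat ^ 'd \<Rightarrow> complex"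
  assumes x: "(\<lambda>\<beta>. cmod (x \<beta>) * \<sigma> ^ multi_degree \<beta>) summable_on UNIV" and "\<sigma> > 0"
    and zero: "\<And>\<beta>. \<beta> \<noteq> \<alpha> \<Longrightarrow> multi_degree \<beta> \<le> multi_degree \<alpha> \<Longrightarrow> x \<beta> = 0"
  shows "\<exists>C\<ge>0. \<forall>\<rho> s. 0 < \<rho> \<longrightarrow> \<rho> \<le> \<sigma> \<longrightarrow>
      ((\<lambda>\<beta>. x \<beta> * of_real \<rho> ^ multi_degree \<beta>) has_sum s) UNIV \<longrightarrow>
      cmod (s / of_real \<rho> ^ multi_degree \<alpha> - x \<alpha>) \<le> C * \<rho>"
proof -
  define n where "n = multi_degree \<alpha>"
  define S where "S = (\<Sum>\<^sub>\<infinity>\<beta>. cmod (x \<beta>) * \<sigma> ^ multi_degree \<beta>)"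
  have S: "((\<lambda>\<beta>. cmod (x \<beta>) * \<sigma> ^ multi_degree \<beta>) has_sum S) UNIV"
    unfolding S_def using x by (rule has_sum_infsum)
  have "S \<ge> 0" unfolding S_def using \<open>\<sigma> > 0\<close> by (intro infsum_nonneg) simp
  have "cmod (s / of_real \<rho> ^ n - x \<alpha>) \<le> S / \<sigma> ^ Suc n * \<rho>"
    if \<rho>: "0 < \<rho>" "\<rho> \<le> \<sigma>"
      and s: "((\<lambda>\<beta>. x \<beta> * of_real \<rho> ^ multi_degree \<beta>) has_sum s) UNIV" for \<rho> s
  proof (rule norm_infsum_le)
    let ?y = "\<lambda>\<beta>. x \<beta> * of_real \<rho> ^ multi_degree \<beta> / of_real \<rho> ^ n - (if \<beta> = \<alpha> then x \<alpha> else 0)"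
    have "((\<lambda>\<beta>. if \<beta> = \<alpha> then x \<alpha> else 0) has_sum x \<alpha>) UNIV"
      by (rule has_sum_finite_neutralI[of "{\<alpha>}"]) auto
    then show "(?y has_sum (s / of_real \<rho> ^ n - x \<alpha>)) UNIV"
      by (intro has_sum_minus has_sum_divide_const s)
    show "((\<lambda>\<beta>. cmod (x \<beta>) * \<sigma> ^ multi_degree \<beta> * (\<rho> / \<sigma> ^ Suc n)) has_sum (S / \<sigma> ^ Suc n * \<rho>)) UNIV"
      using has_sum_cmult_left[OF S, of "\<rho> / \<sigma> ^ Suc n"] by simp
    fix \<beta>
    show "cmod (?y \<beta>) \<le> cmod (x \<beta>) * \<sigma> ^ multi_degree \<beta> * (\<rho> / \<sigma> ^ Suc n)"
    proof (cases "\<beta> = \<alpha> \<or> x \<beta> = 0")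
      case True
      then have "?y \<beta> = 0" using \<rho> by (auto simp: n_def)
      then show ?thesis using \<rho> by simp
    next
      case False
      then have "n < multi_degree \<beta>" using zero[of \<beta>] unfolding n_def by force
      then obtain m where m: "multi_degree \<beta> = Suc (n + m)" using less_iff_Suc_add by auto
      have "\<rho> * \<rho> ^ m \<le> \<rho> * \<sigma> ^ m" using \<rho> by (intro mult_left_mono power_mono) auto
      then have "cmod (x \<beta>) * (\<rho> * \<rho> ^ m) \<le> cmod (x \<beta>) * (\<rho> * \<sigma> ^ m)"
        by (rule mult_left_mono) simp
      then show ?thesis
        using False \<rho> \<open>\<sigma> > 0\<close> unfolding m
        by (simp add: norm_mult norm_divide norm_power power_add field_simps)
    qed
  qed
  then show ?thesis
    using \<open>S \<ge> 0\<close> \<open>\<sigma> > 0\<close> unfolding n_def[symmetric] by (intro exI[of _ "S / \<sigma> ^ Suc n"]) auto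
qed

context taylor_nodes
begin

text \<open>A difference quotient of order \<open>multi_degree \<alpha>\<close> at scale \<rho>,
  which uses only finitely many values of \<open>f\<close>. It is therefore given by an inner
  product in a reproducing kernel space.\<close>

definition taylor_approx :: "(complex ^ 'd \<Rightarrow> complex) \<Rightarrow> real \<Rightarrow> complex" where
  "taylor_approx f \<rho> = (\<Sum>j\<in>J. U j * f (of_real \<rho> *s T j)) / of_real \<rho> ^ multi_degree \<alpha>"

lemma scaled_node_mem:
  assumes "0 < \<rho>" "\<rho> < r"
  shows "of_real \<rho> *s T j \<in> polydisc r"
proof -
  have "\<rho> * cmod (T j $ i) \<le> \<rho> * 1" for i
    using assms nodes_le by (intro mult_left_mono) auto
  then show ?thesis using assms by (auto simp: polydisc_def norm_mult intro: le_less_trans[of _ "\<rho> * 1"])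
qed

lemma taylor_has_sum:
  assumes f: "expands f c r" and \<rho>: "0 < \<rho>" "\<rho> < r"
  shows "((\<lambda>\<beta>. c \<beta> * \<mu> \<beta> * of_real \<rho> ^ multi_degree \<beta>)
    has_sum (\<Sum>j\<in>J. U j * f (of_real \<rho> *s T j))) UNIV"
proof -
  have "((\<lambda>\<beta>. U j * (c \<beta> * multi_power (of_real \<rho> *s T j) \<beta>))
      has_sum U j * f (of_real \<rho> *s T j)) UNIV" for j
    using f scaled_node_mem[OF \<rho>] unfolding expands_def by (intro has_sum_cmult_right) auto
  then have "((\<lambda>\<beta>. \<Sum>j\<in>J. U j * (c \<beta> * multi_power (of_real \<rho> *s T j) \<beta>))
      has_sum (\<Sum>j\<in>J. U j * f (of_real \<rho> *s T j))) UNIV"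
    by (intro has_sum_finite_sum finite_J)
  moreover have "(\<Sum>j\<in>J. U j * (c \<beta> * multi_power (of_real \<rho> *s T j) \<beta>))
      = c \<beta> * \<mu> \<beta> * of_real \<rho> ^ multi_degree \<beta>" for \<beta>
    by (simp add: \<mu>_eq multi_power_scale sum_distrib_left sum_distrib_right mult_ac)
  ultimately show ?thesis by simp
qed

text \<open>This is \<open>leading_coefficient_bound\<close> for the coefficients
  \<open>c \<beta> * \<mu> \<beta>\<close>; since \<open>\<mu>\<close> is bounded by 1, they inherit
  absolute convergence at radius \<open>r / 2\<close> from \<open>c\<close>.\<close>

lemma taylor_approx_bound:
  assumes f: "expands f c r" and r: "0 < r"
  shows "\<exists>C\<ge>0. \<forall>\<rho>. 0 < \<rho> \<longrightarrow> \<rho> \<le> r / 2 \<longrightarrow> cmod (taylor_approx f \<rho> - c \<alpha>) \<le> C * \<rho>"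
proof -
  have "(\<lambda>\<beta>. cmod (c \<beta> * \<mu> \<beta>) * (r / 2) ^ multi_degree \<beta>) summable_on UNIV"
  proof (rule summable_on_comparison_test)
    show "(\<lambda>\<beta>. cmod (c \<beta>) * (r / 2) ^ multi_degree \<beta>) summable_on UNIV"
      using r by (intro expands_summable_norm[OF f]) auto
    show "cmod (c \<beta> * \<mu> \<beta>) * (r / 2) ^ multi_degree \<beta> \<le> cmod (c \<beta>) * (r / 2) ^ multi_degree \<beta>" for \<beta>
      using r norm_\<mu>[of \<beta>] by (intro mult_right_mono) (auto simp: norm_mult mult_left_le)
  qed (use r in auto)
  from leading_coefficient_bound[OF this, of \<alpha>] r \<mu>_eq_0
  obtain C where C: "C \<ge> 0" "\<And>\<rho> s. 0 < \<rho> \<Longrightarrow> \<rho> \<le> r / 2 \<Longrightarrow>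
      ((\<lambda>\<beta>. c \<beta> * \<mu> \<beta> * of_real \<rho> ^ multi_degree \<beta>) has_sum s) UNIV \<Longrightarrow>
      cmod (s / of_real \<rho> ^ multi_degree \<alpha> - c \<alpha> * \<mu> \<alpha>) \<le> C * \<rho>"
    by auto
  show ?thesis
    using C(1) C(2)[OF _ _ taylor_has_sum[OF f]] r unfolding taylor_approx_def
    by (intro exI[of _ C]) (auto simp: \<mu>_self)
qed

lemma taylor_approx_tendsto:
  assumes f: "expands f c r" and r: "0 < r"
    and R: "R \<longlonglongrightarrow> 0" "\<And>n::nat. R n > 0"
  shows "(\<lambda>n. taylor_approx f (R n)) \<longlonglongrightarrow> c \<alpha>"
proof -
  obtain C where C: "\<And>\<rho>. 0 < \<rho> \<Longrightarrow> \<rho> \<le> r / 2 \<Longrightarrow> cmod (taylor_approx f \<rho> - c \<alpha>) \<le> C * \<rho>"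
    using taylor_approx_bound[OF f r] by blast
  have "(\<lambda>n. C * R n) \<longlonglongrightarrow> 0" using tendsto_mult_left[OF R(1), of C] by simp
  moreover have "eventually (\<lambda>n. R n < r / 2) sequentially"
    using R(1) r by (intro order_tendstoD) auto
  then have "eventually (\<lambda>n. norm (taylor_approx f (R n) - c \<alpha>) \<le> C * R n) sequentially"
    by (rule eventually_mono) (use C R(2) in auto)
  ultimately have "(\<lambda>n. taylor_approx f (R n) - c \<alpha>) \<longlonglongrightarrow> 0"
    by (rule Lim_null_comparison[rotated])
  then show ?thesis by (simp add: LIM_zero_iff)
qed

end

text \<open>The quotients \<open>taylor_approx f\<close> depend on the values of \<open>f\<close>
  alone, yet converge to the \<alpha>-th coefficient of either expansion.\<close>

lemma expands_unique:
  assumes "expands f c r" "expands f b r" "0 < r"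
  shows "c = b"
proof
  fix \<alpha> :: "nat ^ 'a"
  obtain J :: "('a \<Rightarrow> nat) set" and U T \<mu> where "taylor_nodes \<alpha> J U T \<mu>"
    by (rule taylor_nodes_exist)
  then interpret taylor_nodes \<alpha> J U T \<mu> .
  have R: "(\<lambda>n. 1 / real (Suc n)) \<longlonglongrightarrow> 0" by (rule lim_1_over_n[THEN LIMSEQ_Suc])
  show "c \<alpha> = b \<alpha>"
    by (rule LIMSEQ_unique[OF taylor_approx_tendsto[OF assms(1,3) R] taylor_approx_tendsto[OF assms(2,3) R]]) auto
qed

subsection \<open>The identity theorem on connected open sets\<close>

text \<open>Complex differentiability along complex lines is all that the identity theorem needs.\<close>

definition line_holomorphic :: "(complex ^ 'd \<Rightarrow> complex) \<Rightarrow> (complex ^ 'd) set \<Rightarrow> bool" where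
  "line_holomorphic h S \<longleftrightarrow> (\<forall>z\<in>S. \<forall>v. (\<lambda>t. h (z + t *s v)) field_differentiable (at 0))"

lemma vec_scale_has_derivative:
  "((\<lambda>t::complex. z + t *s v) has_derivative (\<lambda>t. t *s v)) (at t0 within A)" for v :: "complex ^ 'd"
proof -
  have "linear (\<lambda>t::complex. t *s v)"
    by (rule linearI) (simp_all add: vec_eq_iff algebra_simps)
  then have "bounded_linear (\<lambda>t::complex. t *s v)"
    by (simp add: linear_conv_bounded_linear)
  then show ?thesis
    by (auto intro!: derivative_eq_intros bounded_linear_imp_has_derivative)
qed

text \<open>Along a complex line the chain rule gives the real derivative
  \<open>f' (t *s v)\<close>; complex linearity rewrites it as multiplication by
  \<open>f' v\<close>, which is a complex derivative.\<close>

lemma holomorphic_several_line_holomorphic: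
  assumes "holomorphic_several h S"
  shows "line_holomorphic h S"
  unfolding line_holomorphic_def
proof (intro ballI allI)
  fix z v assume "z \<in> S"
  then obtain f' where f': "(h has_derivative f') (at z)" "\<And>c v. f' (c *s v) = c * f' v"
    using assms unfolding holomorphic_several_def by blast
  have "((\<lambda>t. h (z + t *s v)) has_derivative (\<lambda>t. f' (t *s v))) (at 0)"
    using has_derivative_compose[OF vec_scale_has_derivative[of z v 0 UNIV], of h f'] f'(1) by simp
  then have "((\<lambda>t. h (z + t *s v)) has_field_derivative f' v) (at 0)"
    unfolding has_field_derivative_def f'(2) mult.commute[of _ "f' v"] .
  then show "(\<lambda>t. h (z + t *s v)) field_differentiable at 0"
    by (auto simp: field_differentiable_def)
qed

lemma line_holomorphic_diff:
  "line_holomorphic f S \<Longrightarrow> line_holomorphic g S \<Longrightarrow> line_holomorphic (\<lambda>z. f z - g z) S"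
  unfolding line_holomorphic_def by (auto intro: field_differentiable_diff)

lemma line_holomorphic_subset: "line_holomorphic f S \<Longrightarrow> R \<subseteq> S \<Longrightarrow> line_holomorphic f R"
  unfolding line_holomorphic_def by blast

text \<open>Differentiability at parameter \<open>t0\<close> is differentiability at 0 for the base
  point \<open>z + t0 *s v\<close>.\<close>

lemma line_holomorphic_on_line:
  assumes "line_holomorphic h S"
  shows "(\<lambda>t. h (z + t *s v)) holomorphic_on {t. z + t *s v \<in> S}"
  unfolding holomorphic_on_def
proof
  fix t0 assume "t0 \<in> {t. z + t *s v \<in> S}"
  then have "(\<lambda>t. h ((z + t0 *s v) + t *s v)) field_differentiable (at (t0 - t0))"
    using assms unfolding line_holomorphic_def by auto
  then have "((\<lambda>t. h ((z + t0 *s v) + t *s v)) \<circ> (\<lambda>t. t - t0)) field_differentiable (at t0)"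
    by (intro field_differentiable_compose derivative_intros) auto
  also have "(\<lambda>t. h ((z + t0 *s v) + t *s v)) \<circ> (\<lambda>t. t - t0) = (\<lambda>t. h (z + t *s v))"
    by (auto simp: fun_eq_iff vector_sub_rdistrib algebra_simps)
  finally show "(\<lambda>t. h (z + t *s v)) field_differentiable at t0 within {t. z + t *s v \<in> S}"
    by (rule field_differentiable_at_within)
qed

lemma continuous_on_line: "continuous_on A (\<lambda>t::complex. z + t *s v)"
  by (rule has_derivative_continuous_on) (rule vec_scale_has_derivative)

text \<open>Reduction to one variable on the complex line through \<open>y\<close> and
  \<open>w\<close>. The parameters landing in the large ball form a convex set \<open>A\<close>, the
  function vanishes for parameters near 0, and analytic continuation in \<open>A\<close> reaches
  parameter 1, which is \<open>w\<close>.\<close>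

lemma line_holomorphic_eq_0_ball:
  assumes h: "line_holomorphic h (ball x \<epsilon>)" and y: "y \<in> ball x \<epsilon>"
    and "\<delta> > 0" and zero: "\<And>w. w \<in> ball y \<delta> \<Longrightarrow> h w = 0" and w: "w \<in> ball x \<epsilon>"
  shows "h w = 0"
proof -
  define v where "v = w - y"
  define A where "A = {t. y + t *s v \<in> ball x \<epsilon>}"
  define B where "B = A \<inter> {t. y + t *s v \<in> ball y \<delta>}"
  have op: "open {t. y + t *s v \<in> ball u r}" for u r
    using open_vimage[OF open_ball continuous_on_line] by (simp add: vimage_def)
  have "convex A"
    unfolding convex_alt
  proof (intro ballI allI impI)
    fix s t and u :: real
    assume st: "s \<in> A" "t \<in> A" and u: "0 \<le> u \<and> u \<le> 1"
    have "(1 - u) *\<^sub>R (y + s *s v) + u *\<^sub>R (y + t *s v) \<in> ball x \<epsilon>"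
      using convex_ball[of x \<epsilon>] st u unfolding convex_alt A_def by blast
    also have "(1 - u) *\<^sub>R (y + s *s v) + u *\<^sub>R (y + t *s v)
        = y + ((1 - u) *\<^sub>R s + u *\<^sub>R t) *s v"
      by (simp add: vec_eq_iff) (simp add: scaleR_conv_of_real algebra_simps)
    finally show "(1 - u) *\<^sub>R s + u *\<^sub>R t \<in> A" by (simp add: A_def)
  qed
  have "h (y + 1 *s v) = 0"
  proof (rule analytic_continuation_open[of B A "\<lambda>t. h (y + t *s v)" "\<lambda>_. 0"])
    show "open B" "open A" unfolding A_def B_def by (intro open_Int op)+
    show "connected A" using \<open>convex A\<close> by (rule convex_connected)
    have "0 \<in> B" using \<open>\<delta> > 0\<close> y by (simp add: B_def A_def)
    then show "B \<noteq> {}" by blast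
    show "(\<lambda>t. h (y + t *s v)) holomorphic_on A"
      unfolding A_def by (rule line_holomorphic_on_line[OF h])
    show "1 \<in> A" using w by (simp add: A_def v_def)
  qed (auto simp: B_def zero)
  then show ?thesis by (simp add: v_def)
qed

theorem identity_theorem_several:
  fixes S :: "(complex ^ 'd) set"
  assumes S: "open S" "connected S" and h: "line_holomorphic h S"
    and "a \<in> S" "r > 0" and zero: "\<And>z. z \<in> ball a r \<Longrightarrow> h z = 0" and "z \<in> S"
  shows "h z = 0"
proof -
  define Z where "Z = {y\<in>S. \<exists>\<delta>>0. \<forall>w\<in>ball y \<delta>. h w = 0}"
  \<comment> \<open>A ball inside \<open>S\<close> lies in \<open>Z\<close> as soon as it meets
    \<open>Z\<close>. This dichotomy makes both \<open>Z\<close> and \<open>S - Z\<close> open,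
    after which connectedness of \<open>S\<close> decides.\<close>
  have step: "\<exists>\<epsilon>>0. ball x \<epsilon> \<subseteq> S \<and> (ball x \<epsilon> \<inter> Z \<noteq> {} \<longrightarrow> ball x \<epsilon> \<subseteq> Z)" if "x \<in> S" for x
  proof -
    obtain \<epsilon> where \<epsilon>: "\<epsilon> > 0" "ball x \<epsilon> \<subseteq> S" using S(1) \<open>x \<in> S\<close> open_contains_ball by blast
    have "ball x \<epsilon> \<subseteq> Z" if ne: "ball x \<epsilon> \<inter> Z \<noteq> {}"
    proof
      fix w assume w: "w \<in> ball x \<epsilon>"
      obtain y \<delta> where y: "y \<in> ball x \<epsilon>" "\<delta> > 0" "\<And>w. w \<in> ball y \<delta> \<Longrightarrow> h w = 0"
        using ne unfolding Z_def by blast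
      have h0: "h w' = 0" if "w' \<in> ball x \<epsilon>" for w'
        by (rule line_holomorphic_eq_0_ball[OF line_holomorphic_subset[OF h \<epsilon>(2)] y that])
      obtain \<delta>' where "\<delta>' > 0" "ball w \<delta>' \<subseteq> ball x \<epsilon>"
        using w open_ball[of x \<epsilon>] unfolding open_contains_ball by blast
      then show "w \<in> Z" using w \<epsilon>(2) h0 unfolding Z_def by blast
    qed
    then show ?thesis using \<epsilon> by blast
  qed
  have "open Z" unfolding open_contains_ball
  proof
    fix x assume x: "x \<in> Z"
    then have "x \<in> S" by (simp add: Z_def)
    from step[OF this] obtain \<epsilon> where "\<epsilon> > 0" "ball x \<epsilon> \<inter> Z \<noteq> {} \<longrightarrow> ball x \<epsilon> \<subseteq> Z" by blast
    moreover have "x \<in> ball x \<epsilon> \<inter> Z" using x \<open>\<epsilon> > 0\<close> by simp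
    ultimately show "\<exists>\<epsilon>>0. ball x \<epsilon> \<subseteq> Z" by blast
  qed
  moreover have "open (S - Z)" unfolding open_contains_ball
  proof
    fix x assume x: "x \<in> S - Z"
    then have "x \<in> S" by simp
    from step[OF this] obtain \<epsilon> where \<epsilon>: "\<epsilon> > 0" "ball x \<epsilon> \<subseteq> S" "ball x \<epsilon> \<inter> Z \<noteq> {} \<longrightarrow> ball x \<epsilon> \<subseteq> Z" by blast
    moreover have "\<not> ball x \<epsilon> \<subseteq> Z" using x \<epsilon>(1) centre_in_ball by blast
    ultimately show "\<exists>\<epsilon>>0. ball x \<epsilon> \<subseteq> S - Z" by blast
  qed
  moreover have "a \<in> Z" using assms by (auto simp: Z_def)
  ultimately have "S - Z = {}"
    using connectedD[OF S(2), of Z "S - Z"] \<open>a \<in> S\<close> by blast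
  then have "z \<in> Z" using \<open>z \<in> S\<close> by blast
  then show ?thesis by (auto simp: Z_def)
qed

section \<open>Power series are holomorphic along complex lines\<close>

lemma open_obtain_larger:
  fixes S :: "(complex ^ 'd) set"
  assumes "open S" "z \<in> S"
  obtains w where "w \<in> S" "\<And>i. cmod (z $ i) < cmod (w $ i)"
proof -
  obtain \<epsilon> where \<epsilon>: "\<epsilon> > 0" "ball z \<epsilon> \<subseteq> S" using assms open_contains_ball by blast
  \<comment> \<open>Each coordinate is pushed radially outwards by \<open>s\<close>; the total
    displacement is then at most \<open>\<epsilon> / 2\<close>.\<close>
  define s where "s = \<epsilon> / (2 * real CARD('d))"
  have s: "s > 0" using \<epsilon>(1) by (simp add: s_def)
  \<comment> \<open>A vanishing coordinate has no radial direction, as \<open>sgn 0 = 0\<close>, and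
    is moved to \<open>s\<close> instead.\<close>
  define w where "w = (\<chi> i. if z $ i = 0 then of_real s else z $ i + of_real s * sgn (z $ i))"
  have "cmod ((w - z) $ i) = s" for i
    using s by (auto simp: w_def norm_mult norm_sgn)
  then have "norm (w - z) \<le> (\<Sum>i\<in>(UNIV::'d set). s)"
    unfolding norm_vec_def using s by (intro order_trans[OF L2_set_le_sum]) auto
  also have "\<dots> < \<epsilon>" using \<epsilon>(1) by (simp add: s_def)
  finally have "w \<in> S" using \<epsilon>(2) by (auto simp: dist_norm norm_minus_commute)
  moreover have "cmod (z $ i) < cmod (w $ i)" for i
  proof (cases "z $ i = 0")
    case False
    have "z $ i + of_real s * sgn (z $ i) = of_real (cmod (z $ i) + s) * sgn (z $ i)"
      using False by (simp add: sgn_eq field_simps)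
    then have "cmod (w $ i) = cmod (of_real (cmod (z $ i) + s) * sgn (z $ i))"
      using False by (simp add: w_def)
    also have "\<dots> = \<bar>cmod (z $ i) + s\<bar>" using False by (simp only: norm_mult norm_of_real norm_sgn) simp
    finally show ?thesis using s by simp
  qed (use s in \<open>simp add: w_def\<close>)
  ultimately show ?thesis by (rule that)
qed

text \<open>Absolute convergence at a point \<open>w\<close> of \<open>S\<close> with strictly
  larger coordinate moduli dominates the series near \<open>z\<close>. On a small disc of the line
  the partial sums, which are polynomials, thus converge uniformly, and the limit is
  holomorphic.\<close>

lemma power_series_line_holomorphic:
  fixes S :: "(complex ^ 'd) set"
  assumes "open S" and f: "\<And>z. z \<in> S \<Longrightarrow> ((\<lambda>\<alpha>. c \<alpha> * multi_power z \<alpha>) has_sum f z) UNIV"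
  shows "line_holomorphic f S"
  unfolding line_holomorphic_def
proof (intro ballI allI)
  fix z v :: "complex ^ 'd" assume "z \<in> S"
  then obtain w where w: "w \<in> S" "\<And>i. cmod (z $ i) < cmod (w $ i)"
    using open_obtain_larger[OF \<open>open S\<close>] by blast
  define A where "A = {u. \<forall>i. cmod (u $ i) < cmod (w $ i)} \<inter> S"
  have "open {u :: complex ^ 'd. \<forall>i. cmod (u $ i) < cmod (w $ i)}"
    unfolding Collect_all_eq by (intro open_INT ballI open_Collect_less continuous_intros) auto
  then have "open A" using \<open>open S\<close> by (auto simp: A_def)
  then have "open {t. z + t *s v \<in> A}"
    using open_vimage[OF _ continuous_on_line] by (simp add: vimage_def)
  moreover have "0 \<in> {t. z + t *s v \<in> A}" using w \<open>z \<in> S\<close> by (simp add: A_def)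
  ultimately obtain \<delta> where \<delta>: "\<delta> > 0" "cball 0 \<delta> \<subseteq> {t. z + t *s v \<in> A}"
    by (meson open_contains_cball)
  have lim: "uniform_limit (cball 0 \<delta>) (\<lambda>F t. \<Sum>\<alpha>\<in>F. c \<alpha> * multi_power (z + t *s v) \<alpha>)
      (\<lambda>t. f (z + t *s v)) (finite_subsets_at_top UNIV)"
  proof (rule Weierstrass_m_test_general')
    show "(\<lambda>\<alpha>. cmod (c \<alpha> * multi_power w \<alpha>)) summable_on UNIV"
      using f[OF w(1)] unfolding summable_on_iff_abs_summable_on_complex[symmetric]
      by (rule has_sum_imp_summable)
    fix t :: complex assume "t \<in> cball 0 \<delta>"
    then have t: "z + t *s v \<in> A" using \<delta>(2) by blast
    show "((\<lambda>\<alpha>. c \<alpha> * multi_power (z + t *s v) \<alpha>) has_sum f (z + t *s v)) UNIV"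
      using f t by (simp add: A_def)
    have "cmod ((z + t *s v) $ i) \<le> cmod (w $ i)" for i
      using t unfolding A_def by (auto intro: less_imp_le)
    then show "norm (c \<alpha> * multi_power (z + t *s v) \<alpha>) \<le> cmod (c \<alpha> * multi_power w \<alpha>)" for \<alpha>
      unfolding norm_mult by (intro mult_left_mono norm_multi_power_le) auto
  qed
  have "(\<lambda>t. \<Sum>\<alpha>\<in>F. c \<alpha> * multi_power (z + t *s v) \<alpha>) holomorphic_on X" for F X
    unfolding multi_power_def by (auto intro!: holomorphic_intros)
  then have hol: "\<forall>\<^sub>F F in finite_subsets_at_top UNIV.
      continuous_on (cball 0 \<delta>) (\<lambda>t. \<Sum>\<alpha>\<in>F. c \<alpha> * multi_power (z + t *s v) \<alpha>) \<and>
      (\<lambda>t. \<Sum>\<alpha>\<in>F. c \<alpha> * multi_power (z + t *s v) \<alpha>) holomorphic_on ball 0 \<delta>"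
    by (intro always_eventually) (blast intro: holomorphic_on_imp_continuous_on)
  have "(\<lambda>t. f (z + t *s v)) holomorphic_on ball 0 \<delta>"
    by (rule holomorphic_uniform_limit[OF hol lim]) auto
  then show "(\<lambda>t. f (z + t *s v)) field_differentiable at 0"
    by (rule holomorphic_on_imp_differentiable_at) (use \<delta>(1) in auto)
qed

subsection \<open>The Hilbert space of a diagonal holomorphic kernel\<close>

lemma open_polydisc: "open (polydisc r)"
  unfolding polydisc_def Collect_all_eq
  by (intro open_INT ballI open_Collect_less continuous_intros) auto

lemma ball_subset_polydisc: "ball 0 r \<subseteq> polydisc r"
proof
  fix z :: "complex ^ 'a" assume "z \<in> ball 0 r"
  then show "z \<in> polydisc r" using Finite_Cartesian_Product.norm_nth_le[of z] by (auto simp: polydisc_def intro: le_less_trans)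
qed

lemma polydisc_subset_ball:
  fixes r :: real
  assumes "r > 0"
  shows "polydisc (r / CARD('d)) \<subseteq> (ball 0 r :: (complex ^ 'd) set)"
proof
  fix z :: "complex ^ 'd" assume "z \<in> polydisc (r / CARD('d))"
  then have "(\<Sum>i\<in>UNIV. cmod (z $ i)) < (\<Sum>i\<in>(UNIV :: 'd set). r / CARD('d))"
    by (intro sum_strict_mono) (auto simp: polydisc_def)
  moreover have "norm z \<le> (\<Sum>i\<in>UNIV. cmod (z $ i))"
    unfolding norm_vec_def by (intro L2_set_le_sum) auto
  ultimately show "z \<in> ball 0 r" by simp
qed

text \<open>The hypotheses in working form: the weights are fixed, the ball of convergence is
  replaced by a polydisc because the estimates are coordinatewise, and holomorphy is reduced to
  complex lines.\<close>

locale diagonal_rkhs = rkhs \<Omega> k H ip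
  for \<Omega> :: "(complex ^ 'd) set" and k H ip +
  fixes a :: "nat ^ 'd \<Rightarrow> real" and r :: real
  assumes open_dom: "open \<Omega>" and connected_dom: "connected \<Omega>"
    and r_pos: "r > 0" and polydisc_subset: "polydisc r \<subseteq> \<Omega>"
    and weight_pos: "a \<alpha> > 0"
    and kernel_holomorphic: "w \<in> \<Omega> \<Longrightarrow> line_holomorphic (\<lambda>z. k z w) \<Omega>"
    and kernel_expansion: "z \<in> polydisc r \<Longrightarrow> w \<in> polydisc r \<Longrightarrow>
      ((\<lambda>\<alpha>. complex_of_real (a \<alpha>) * multi_power z \<alpha> * cnj (multi_power w \<alpha>)) has_sum k z w) UNIV"
begin

lemma zero_in_dom: "0 \<in> \<Omega>"
  using polydisc_subset r_pos by (auto simp: polydisc_def)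

lemma kernel_fun_apply: "z \<in> \<Omega> \<Longrightarrow> kernel_fun \<Omega> k w z = k z w"
  by (simp add: kernel_fun_def zero_ext_def)

text \<open>Both values are inner products of the same two kernel functions. This symmetry converts
  continuation in the first variable into statements about the second.\<close>

lemma kernel_commute: "z \<in> \<Omega> \<Longrightarrow> w \<in> \<Omega> \<Longrightarrow> k w z = cnj (k z w)"
  using reproducing[OF kernel_mem, of w z] reproducing[OF kernel_mem, of z w]
    ip_commute[OF kernel_mem kernel_mem, of w z] by (simp add: kernel_fun_apply)

text \<open>For \<open>z\<close> small the series converges for all \<open>w\<close> in a large polydisc, so it continues
  \<open>k z\<close> along a path from \<open>0\<close> to \<open>w\<close> inside that polydisc.\<close>

lemma expands_kernel_ex:
  assumes w: "w \<in> \<Omega>"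
  shows "\<exists>s>0. expands (\<lambda>z. k z w) (\<lambda>\<alpha>. a \<alpha> * cnj (multi_power w \<alpha>)) s"
proof -
  have "path_connected \<Omega>" using open_dom connected_dom by (simp add: connected_open_path_connected)
  then obtain g where g: "path g" "path_image g \<subseteq> \<Omega>" "pathstart g = 0" "pathfinish g = w"
    using zero_in_dom w unfolding path_connected_def by blast
  obtain B where B: "\<And>x. x \<in> path_image g \<Longrightarrow> norm x \<le> B"
    using compact_imp_bounded[OF compact_path_image[OF g(1)]] unfolding bounded_iff by blast
  define R where "R = \<bar>B\<bar> + 1"
  have R: "R > 0" by (simp add: R_def)
  have in_R: "path_image g \<subseteq> polydisc R"
  proof
    fix x assume "x \<in> path_image g"
    then have "x \<in> ball 0 R" using B[of x] by (simp add: R_def)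
    then show "x \<in> polydisc R" using ball_subset_polydisc by blast
  qed
  \<comment> \<open>On this open connected set both the kernel and its series are available; it
    contains the whole path, hence \<open>w\<close>.\<close>
  define S where "S = connected_component_set (\<Omega> \<inter> polydisc R) 0"
  have S: "open S" "connected S" "S \<subseteq> \<Omega>" "S \<subseteq> polydisc R"
    using open_dom open_polydisc[of R] connected_component_subset[of "\<Omega> \<inter> polydisc R" 0]
    by (auto simp: S_def intro: open_connected_component)
  have ends: "0 \<in> path_image g" "w \<in> path_image g"
    using g pathstart_in_path_image[of g] pathfinish_in_path_image[of g] by auto
  have "path_image g \<subseteq> S"
    unfolding S_def using g in_R ends(1)
    by (intro connected_component_maximal connected_path_image) auto
  with ends have "0 \<in> S" "w \<in> S" by auto
  define \<tau> where "\<tau> = r / 2"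
  have \<tau>: "0 < \<tau>" "\<tau> < r" using r_pos by (auto simp: \<tau>_def)
  \<comment> \<open>For \<open>z\<close> in \<open>polydisc s\<close> and \<open>u\<close> in
    \<open>polydisc R\<close> the products of coordinates satisfy
    \<open>cmod (z $ i * u $ i) \<le> \<tau> * \<tau>\<close>, so the series is dominated by that of
    the kernel at the point with all coordinates \<tau>.\<close>
  define s where "s = min \<tau> (\<tau> * \<tau> / R)"
  have s: "s > 0" "s \<le> \<tau>" "R * s \<le> \<tau> * \<tau>"
    using \<tau> R by (auto simp: s_def field_simps min_def)
  have "k z w = cnj (\<Sum>\<^sub>\<infinity>\<alpha>. a \<alpha> * cnj (multi_power z \<alpha>) * multi_power w \<alpha>) \<and>
      (\<lambda>\<alpha>. a \<alpha> * cnj (multi_power z \<alpha>) * multi_power w \<alpha>) summable_on UNIV"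
    if z: "z \<in> polydisc s" for z
  proof -
    have z': "z \<in> polydisc r" using z s(2) \<tau>(2) by (auto simp: polydisc_def intro: less_trans less_le_trans)
    then have "z \<in> \<Omega>" using polydisc_subset by blast
    define f where "f u = (\<Sum>\<^sub>\<infinity>\<alpha>. a \<alpha> * cnj (multi_power z \<alpha>) * multi_power u \<alpha>)" for u
    have summable: "(\<lambda>\<alpha>. a \<alpha> * cnj (multi_power z \<alpha>) * multi_power u \<alpha>) summable_on UNIV"
      if u: "u \<in> polydisc R" for u
    proof -
      define x :: "complex ^ 'd" where "x = (\<chi> i. of_real \<tau>)"
      have x: "x \<in> polydisc r" using \<tau> by (simp add: x_def polydisc_def)
      have "(\<lambda>\<alpha>. cmod (a \<alpha> * multi_power x \<alpha> * cnj (multi_power x \<alpha>))) summable_on UNIV"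
        using kernel_expansion[OF x x] unfolding summable_on_iff_abs_summable_on_complex[symmetric]
        by (rule has_sum_imp_summable)
      then have "(\<lambda>\<alpha>. cmod (a \<alpha> * cnj (multi_power z \<alpha>) * multi_power u \<alpha>)) summable_on UNIV"
      proof (rule Infinite_Sum.abs_summable_on_comparison_test')
        fix \<alpha>
        have "cmod (multi_power (\<chi> i. z $ i * u $ i) \<alpha>) \<le> cmod (multi_power (\<chi> i. x $ i * x $ i) \<alpha>)"
        proof (rule norm_multi_power_le)
          fix i
          have "cmod (z $ i) * cmod (u $ i) \<le> s * R"
            using z u s R by (intro mult_mono) (auto simp: polydisc_def less_imp_le)
          then show "cmod ((\<chi> i. z $ i * u $ i) $ i) \<le> cmod ((\<chi> i. x $ i * x $ i) $ i)"
            using s(3) \<tau> by (simp add: norm_mult x_def mult.commute)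
        qed
        then show "cmod (a \<alpha> * cnj (multi_power z \<alpha>) * multi_power u \<alpha>)
            \<le> cmod (a \<alpha> * multi_power x \<alpha> * cnj (multi_power x \<alpha>))"
          unfolding multi_power_mult by (simp add: norm_mult mult.assoc mult_left_mono)
      qed
      then show ?thesis unfolding summable_on_iff_abs_summable_on_complex[symmetric] .
    qed
    \<comment> \<open>With \<open>z\<close> fixed and small, \<open>k u z\<close> and the series
      \<open>f u\<close> agree for \<open>u\<close> near 0, and the identity theorem on
      \<open>S\<close> carries this to \<open>w\<close>. Conjugation then swaps the
      arguments.\<close>
    have "k w z - f w = 0"
    proof (rule identity_theorem_several[where h = "\<lambda>u. k u z - f u", OF S(1,2) _ \<open>0 \<in> S\<close> _ _ \<open>w \<in> S\<close>])
      have "line_holomorphic f (polydisc R)"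
        by (rule power_series_line_holomorphic[OF open_polydisc])
           (auto simp: f_def intro: has_sum_infsum summable)
      then show "line_holomorphic (\<lambda>u. k u z - f u) S"
        using S kernel_holomorphic[OF \<open>z \<in> \<Omega>\<close>]
        by (intro line_holomorphic_diff) (auto intro: line_holomorphic_subset)
      show "r > 0" by (rule r_pos)
      fix u :: "complex ^ 'd" assume "u \<in> ball 0 r"
      then have "u \<in> polydisc r" using ball_subset_polydisc by blast
      then show "k u z - f u = 0"
        using kernel_expansion[OF _ z', of u] by (simp add: f_def infsumI mult_ac)
    qed
    then show ?thesis
      using summable[of w] kernel_commute[OF w \<open>z \<in> \<Omega>\<close>] S(4) \<open>w \<in> S\<close> by (auto simp: f_def)
  qed
  then have "((\<lambda>\<alpha>. cnj (a \<alpha> * cnj (multi_power z \<alpha>) * multi_power w \<alpha>)) has_sum k z w) UNIV"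
    if "z \<in> polydisc s" for z
    using that by (subst complex_cnj_cnj[symmetric, of "k z w"], subst has_sum_cnj_iff) (auto intro: has_sum_infsum)
  then have "expands (\<lambda>z. k z w) (\<lambda>\<alpha>. a \<alpha> * cnj (multi_power w \<alpha>)) s"
    by (simp add: expands_def mult_ac)
  then show ?thesis using s(1) by blast
qed

section \<open>Monomials as an orthogonal family in the Hilbert space\<close>

definition monomial :: "nat ^ 'd \<Rightarrow> complex ^ 'd \<Rightarrow> complex" where
  "monomial \<alpha> = zero_ext \<Omega> (\<lambda>z. multi_power z \<alpha>)"

lemma monomial_apply: "z \<in> \<Omega> \<Longrightarrow> monomial \<alpha> z = multi_power z \<alpha>"
  by (simp add: monomial_def zero_ext_def)

text \<open>The representers of the finite-difference functionals converge in norm to a multiple of the monomial.\<close>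

lemma monomial_representer:
  shows "monomial \<alpha> \<in> H"
    and "f \<in> H \<Longrightarrow> expands f c s \<Longrightarrow> s > 0 \<Longrightarrow> a \<alpha> * ip f (monomial \<alpha>) = c \<alpha>"
proof -
  obtain J :: "('d \<Rightarrow> nat) set" and U T \<mu> where "taylor_nodes \<alpha> J U T \<mu>"
    by (rule taylor_nodes_exist)
  then interpret taylor_nodes \<alpha> J U T \<mu> .
  let ?n = "multi_degree \<alpha>"
  \<comment> \<open>The representer of \<open>taylor_approx\<close> at scale \<rho>; the weights are
    conjugated because \<open>ip\<close> is conjugate-linear in its second argument.\<close>
  define E where "E \<rho> = (\<lambda>z. \<Sum>j\<in>J. cnj (U j) / of_real \<rho> ^ ?n * kernel_fun \<Omega> k (of_real \<rho> *s T j) z)" for \<rho> :: real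
  have node: "of_real \<rho> *s T j \<in> polydisc r" "of_real \<rho> *s T j \<in> \<Omega>" if "0 < \<rho>" "\<rho> < r" for \<rho> j
    using scaled_node_mem[OF that] polydisc_subset by auto
  have E_mem: "E \<rho> \<in> H" if "0 < \<rho>" "\<rho> < r" for \<rho>
    unfolding E_def by (intro sum_mem kernel_mem node that)
  have ip_E: "ip f (E \<rho>) = taylor_approx f \<rho>" if "f \<in> H" "0 < \<rho>" "\<rho> < r" for f \<rho>
    unfolding E_def taylor_approx_def using that node
    by (subst ip_sum_right) (auto simp: kernel_mem reproducing[symmetric] sum_divide_distrib)
  have E_expands: "expands (E \<rho>) (\<lambda>\<beta>. a \<beta> * cnj (\<mu> \<beta>) * of_real \<rho> ^ multi_degree \<beta> / of_real \<rho> ^ ?n) r"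
    if \<rho>: "0 < \<rho>" "\<rho> < r" for \<rho>
    unfolding expands_def
  proof
    fix z :: "complex ^ 'd" assume z: "z \<in> polydisc r"
    have "((\<lambda>\<beta>. \<Sum>j\<in>J. cnj (U j) / of_real \<rho> ^ ?n *
        (a \<beta> * multi_power z \<beta> * cnj (multi_power (of_real \<rho> *s T j) \<beta>))) has_sum
        (\<Sum>j\<in>J. cnj (U j) / of_real \<rho> ^ ?n * k z (of_real \<rho> *s T j))) UNIV"
      by (intro has_sum_finite_sum finite_J has_sum_cmult_right kernel_expansion z node \<rho>)
    moreover have "(\<Sum>j\<in>J. cnj (U j) / of_real \<rho> ^ ?n * k z (of_real \<rho> *s T j)) = E \<rho> z"
      using z polydisc_subset by (auto simp: E_def kernel_fun_apply)
    moreover have "(\<Sum>j\<in>J. cnj (U j) / of_real \<rho> ^ ?n *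
        (a \<beta> * multi_power z \<beta> * cnj (multi_power (of_real \<rho> *s T j) \<beta>)))
        = a \<beta> * cnj (\<mu> \<beta>) * of_real \<rho> ^ multi_degree \<beta> / of_real \<rho> ^ ?n * multi_power z \<beta>" for \<beta>
      by (simp add: \<mu>_eq multi_power_scale sum_distrib_left sum_distrib_right sum_divide_distrib mult_ac)
    ultimately show "((\<lambda>\<beta>. a \<beta> * cnj (\<mu> \<beta>) * of_real \<rho> ^ multi_degree \<beta> / of_real \<rho> ^ ?n * multi_power z \<beta>)
        has_sum E \<rho> z) UNIV" by simp
  qed
  define \<tau> where "\<tau> = r / 2"
  have \<tau>: "0 < \<tau>" "\<tau> < r" using r_pos by (auto simp: \<tau>_def)
  define x where "x \<beta> = a \<beta> * cnj (\<mu> \<beta>) * \<mu> \<beta>" for \<beta>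
  \<comment> \<open>Applying the difference quotient at scale \<sigma> to the expansion of
    \<open>E \<rho>\<close> yields a series in the single parameter
    \<open>\<rho> * \<sigma>\<close>, with leading coefficient \<open>a \<alpha>\<close>.\<close>
  have ip_EE: "((\<lambda>\<beta>. x \<beta> * of_real (\<rho> * \<sigma>) ^ multi_degree \<beta>) has_sum
      of_real (\<rho> * \<sigma>) ^ ?n * ip (E \<rho>) (E \<sigma>)) UNIV" if \<rho>: "0 < \<rho>" "\<rho> < r" and \<sigma>: "0 < \<sigma>" "\<sigma> < r" for \<rho> \<sigma>
  proof -
    have "((\<lambda>\<beta>. of_real \<rho> ^ ?n * (a \<beta> * cnj (\<mu> \<beta>) * of_real \<rho> ^ multi_degree \<beta> / of_real \<rho> ^ ?n * \<mu> \<beta>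
        * of_real \<sigma> ^ multi_degree \<beta>)) has_sum
        of_real \<rho> ^ ?n * (\<Sum>j\<in>J. U j * E \<rho> (of_real \<sigma> *s T j))) UNIV"
      by (intro has_sum_cmult_right taylor_has_sum[OF E_expands]) (use \<rho> \<sigma> in auto)
    moreover have "ip (E \<rho>) (E \<sigma>) = (\<Sum>j\<in>J. U j * E \<rho> (of_real \<sigma> *s T j)) / of_real \<sigma> ^ ?n"
      using ip_E[OF E_mem[OF \<rho>] \<sigma>] by (simp add: taylor_approx_def)
    ultimately show ?thesis
      using \<rho> \<sigma> by (simp add: x_def power_mult_distrib mult_ac)
  qed
  have "(\<lambda>\<beta>. cmod (x \<beta>) * (\<tau> * \<tau>) ^ multi_degree \<beta>) summable_on UNIV"
  proof -
    have "(\<lambda>\<beta>. cmod (x \<beta> * of_real (\<tau> * \<tau>) ^ multi_degree \<beta>)) summable_on UNIV"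
      using ip_EE[OF \<tau> \<tau>] unfolding summable_on_iff_abs_summable_on_complex[symmetric]
      by (rule has_sum_imp_summable)
    then show ?thesis using \<tau> by (simp add: norm_mult norm_power)
  qed
  from leading_coefficient_bound[OF this, of \<alpha>] \<tau> \<mu>_eq_0
  obtain C where C: "C \<ge> 0" "\<And>\<rho> s. 0 < \<rho> \<Longrightarrow> \<rho> \<le> \<tau> * \<tau> \<Longrightarrow>
      ((\<lambda>\<beta>. x \<beta> * of_real \<rho> ^ multi_degree \<beta>) has_sum s) UNIV \<Longrightarrow>
      cmod (s / of_real \<rho> ^ ?n - x \<alpha>) \<le> C * \<rho>"
    by (auto simp: x_def)
  have ip_EE_bound: "cmod (ip (E \<rho>) (E \<sigma>) - a \<alpha>) \<le> C * (\<rho> * \<sigma>)"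
    if "0 < \<rho>" "\<rho> \<le> \<tau>" "0 < \<sigma>" "\<sigma> \<le> \<tau>" for \<rho> \<sigma>
  proof -
    have "\<rho> * \<sigma> \<le> \<tau> * \<tau>" using that by (intro mult_mono) auto
    moreover have "x \<alpha> = a \<alpha>" by (simp add: x_def \<mu>_self)
    ultimately show ?thesis
      using C(2)[of "\<rho> * \<sigma>", OF _ _ ip_EE] that \<tau> by simp
  qed
  \<comment> \<open>The four inner products in the squared norm share the leading value
    \<open>a \<alpha>\<close>, which cancels. Only the errors from \<open>ip_EE_bound\<close>
    remain, so the representers are Cauchy as \<rho> tends to 0.\<close>
  have norm_EE: "(ip_norm ip (\<lambda>z. E \<rho> z - E \<sigma> z))\<^sup>2 \<le> C * (\<rho> + \<sigma>)\<^sup>2"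
    if \<rho>: "0 < \<rho>" "\<rho> \<le> \<tau>" and \<sigma>: "0 < \<sigma>" "\<sigma> \<le> \<tau>" for \<rho> \<sigma>
  proof -
    have mem: "E \<rho> \<in> H" "E \<sigma> \<in> H" using \<rho> \<sigma> \<tau> by (auto intro: E_mem)
    let ?d = "\<lambda>\<rho> \<sigma>. ip (E \<rho>) (E \<sigma>) - a \<alpha>"
    have "of_real ((ip_norm ip (\<lambda>z. E \<rho> z - E \<sigma> z))\<^sup>2) = (?d \<rho> \<rho> - ?d \<rho> \<sigma>) - (?d \<sigma> \<rho> - ?d \<sigma> \<sigma>)"
      using mem ip_self[OF diff_mem[OF mem]] by (simp add: ip_diff ip_diff_right diff_mem)
    then have "(ip_norm ip (\<lambda>z. E \<rho> z - E \<sigma> z))\<^sup>2 = cmod ((?d \<rho> \<rho> - ?d \<rho> \<sigma>) - (?d \<sigma> \<rho> - ?d \<sigma> \<sigma>))"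
      by (metis norm_of_real abs_power2)
    also have "\<dots> \<le> (cmod (?d \<rho> \<rho>) + cmod (?d \<rho> \<sigma>)) + (cmod (?d \<sigma> \<rho>) + cmod (?d \<sigma> \<sigma>))"
      by (intro order_trans[OF norm_triangle_ineq4] add_mono norm_triangle_ineq4)
    also have "\<dots> \<le> (C * (\<rho> * \<rho>) + C * (\<rho> * \<sigma>)) + (C * (\<sigma> * \<rho>) + C * (\<sigma> * \<sigma>))"
      using \<rho> \<sigma> by (intro add_mono ip_EE_bound)
    also have "\<dots> = C * (\<rho> + \<sigma>)\<^sup>2" by (simp add: power2_eq_square algebra_simps)
    finally show ?thesis .
  qed
  define R where "R n = \<tau> * (1 / real (Suc n))" for n
  have R: "R \<longlonglongrightarrow> 0" "\<And>n. R n > 0" "\<And>n. R n \<le> \<tau>"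
  proof -
    show "R \<longlonglongrightarrow> 0"
      unfolding R_def using tendsto_mult_left[OF LIMSEQ_Suc[OF lim_1_over_n], of \<tau>] by simp
  qed (use \<tau> in \<open>auto simp: R_def field_simps\<close>)
  have R': "R n < r" for n using R(3)[of n] \<tau> by simp
  have "\<exists>V\<in>H. (\<lambda>n. ip_norm ip (\<lambda>z. E (R n) z - V z)) \<longlonglongrightarrow> 0"
  proof (rule complete)
    show "E (R n) \<in> H" for n by (intro E_mem R R')
    fix \<epsilon> :: real assume \<epsilon>: "\<epsilon> > 0"
    have "(\<lambda>n. C * (2 * R n)\<^sup>2) \<longlonglongrightarrow> C * (2 * 0)\<^sup>2"
      by (intro tendsto_intros R)
    then have "eventually (\<lambda>n. C * (2 * R n)\<^sup>2 < \<epsilon>\<^sup>2) sequentially"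
      using \<epsilon> by (intro order_tendstoD) auto
    then obtain N where N: "C * (2 * R N)\<^sup>2 < \<epsilon>\<^sup>2" by (auto simp: eventually_sequentially)
    have "ip_norm ip (\<lambda>z. E (R m) z - E (R n) z) < \<epsilon>" if "m \<ge> N" "n \<ge> N" for m n
    proof (rule power2_less_imp_less)
      have "R m \<le> R N" "R n \<le> R N" using that \<tau> by (auto simp: R_def field_simps)
      then have "C * (R m + R n)\<^sup>2 \<le> C * (2 * R N)\<^sup>2"
        using R(2)[of m] R(2)[of n] C(1) by (intro mult_left_mono power_mono) auto
      then show "(ip_norm ip (\<lambda>z. E (R m) z - E (R n) z))\<^sup>2 < \<epsilon>\<^sup>2"
        using norm_EE[OF R(2,3) R(2,3), of m n] N by linarith
    qed (use \<epsilon> in simp)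
    then show "\<exists>N. \<forall>m\<ge>N. \<forall>n\<ge>N. ip_norm ip (\<lambda>z. E (R m) z - E (R n) z) < \<epsilon>" by blast
  qed
  then obtain V where V: "V \<in> H" "(\<lambda>n. ip_norm ip (\<lambda>z. E (R n) z - V z)) \<longlonglongrightarrow> 0" by blast
  \<comment> \<open>The limit \<open>V\<close> represents the functional taking the \<alpha>-th
    Taylor coefficient.\<close>
  have ip_V: "ip f V = c \<alpha>" if f: "f \<in> H" "expands f c s" "s > 0" for f c s
  proof -
    have "(\<lambda>n. ip (E (R n)) f) \<longlonglongrightarrow> ip V f"
      by (rule ip_tendsto) (use V f E_mem R R' in auto)
    then have "(\<lambda>n. cnj (ip (E (R n)) f)) \<longlonglongrightarrow> cnj (ip V f)" by (rule tendsto_cnj)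
    moreover have "cnj (ip (E (R n)) f) = taylor_approx f (R n)" for n
      using ip_E[OF f(1) R(2) R'] ip_commute[OF E_mem[OF R(2) R'] f(1)] by simp
    ultimately have "(\<lambda>n. taylor_approx f (R n)) \<longlonglongrightarrow> ip f V"
      using ip_commute[OF V(1) f(1)] by simp
    then show ?thesis
      using taylor_approx_tendsto[OF f(2,3) R(1,2)] LIMSEQ_unique by blast
  qed
  \<comment> \<open>The value of \<open>V\<close> at \<open>w\<close> is conjugate to the
    \<alpha>-th Taylor coefficient of the kernel function at \<open>w\<close>. To identify
    \<open>V\<close> on all of \<Omega>, that coefficient is needed for every \<open>w\<close>, as
    \<open>expands_kernel_ex\<close> supplies.\<close>
  have V_eq: "V = (\<lambda>z. a \<alpha> * monomial \<alpha> z)"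
  proof
    fix w
    show "V w = a \<alpha> * monomial \<alpha> w"
    proof (cases "w \<in> \<Omega>")
      case True
      obtain s where s: "s > 0" "expands (\<lambda>z. k z w) (\<lambda>\<alpha>. a \<alpha> * cnj (multi_power w \<alpha>)) s"
        using expands_kernel_ex[OF True] by blast
      \<comment> \<open>Radius \<open>min s r\<close> keeps \<open>z\<close> inside \<Omega>, where
        the zero extension agrees with the kernel.\<close>
      have "expands (kernel_fun \<Omega> k w) (\<lambda>\<alpha>. a \<alpha> * cnj (multi_power w \<alpha>)) (min s r)"
        unfolding expands_def
      proof
        fix z :: "complex ^ 'd" assume "z \<in> polydisc (min s r)"
        then have "z \<in> polydisc s" "z \<in> polydisc r"
          by (simp_all add: polydisc_def)
        then have "z \<in> polydisc s" "z \<in> \<Omega>" using polydisc_subset by auto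
        then show "((\<lambda>\<alpha>. a \<alpha> * cnj (multi_power w \<alpha>) * multi_power z \<alpha>) has_sum kernel_fun \<Omega> k w z) UNIV"
          using s(2) by (simp add: expands_def kernel_fun_apply)
      qed
      then have "ip (kernel_fun \<Omega> k w) V = a \<alpha> * cnj (multi_power w \<alpha>)"
        using True s(1) r_pos by (intro ip_V[of _ _ "min s r"] kernel_mem) auto
      then show ?thesis
        using reproducing[OF V(1) True] ip_commute[OF kernel_mem[OF True] V(1)] True
        by (simp add: monomial_apply)
    qed (simp add: zero_outside V monomial_def zero_ext_def)
  qed
  show mem: "monomial \<alpha> \<in> H"
    using scale_mem[OF V(1), of "1 / a \<alpha>"] weight_pos[of \<alpha>] by (simp add: V_eq)
  show "a \<alpha> * ip f (monomial \<alpha>) = c \<alpha>" if "f \<in> H" "expands f c s" "s > 0"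
    using ip_V[OF that] ip_scale_right[OF that(1) mem, of "of_real (a \<alpha>)"] by (simp add: V_eq)
qed

text \<open>The Taylor series of a monomial has a single term, so the coefficient formula in
  \<open>monomial_representer\<close> is itself the orthogonality relation.\<close>

sublocale orthogonal_family \<Omega> H ip monomial a
proof
  show "monomial \<alpha> \<in> H" for \<alpha> by (rule monomial_representer)
  show "a \<alpha> > 0" for \<alpha> by (rule weight_pos)
  show "ip (monomial \<beta>) (monomial \<alpha>) = (if \<beta> = \<alpha> then of_real (inverse (a \<beta>)) else 0)" for \<alpha> \<beta>
  proof -
    have "expands (monomial \<beta>) (\<lambda>\<gamma>. if \<gamma> = \<beta> then 1 else 0) r"
      unfolding expands_def
    proof
      fix z :: "complex ^ 'd" assume "z \<in> polydisc r"
      then show "((\<lambda>\<gamma>. (if \<gamma> = \<beta> then 1 else 0) * multi_power z \<gamma>) has_sum monomial \<beta> z) UNIV"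
        using polydisc_subset
        by (intro has_sum_finite_neutralI[of "{\<beta>}"]) (auto simp: monomial_apply)
    qed
    then have "a \<alpha> * ip (monomial \<beta>) (monomial \<alpha>) = (if \<alpha> = \<beta> then 1 else 0)"
      using monomial_representer r_pos by blast
    then show ?thesis using weight_pos[of \<alpha>] by (auto simp: field_simps split: if_splits)
  qed
qed

lemma coef_expands:
  assumes "f \<in> H" "expands f c s" "s > 0"
  shows "coef f = c"
  using monomial_representer(2)[OF assms] by (simp add: coef_def fun_eq_iff)

lemma ip_kernel_monomial: "w \<in> \<Omega> \<Longrightarrow> ip (kernel_fun \<Omega> k w) (monomial \<alpha>) = cnj (multi_power w \<alpha>)"
  using reproducing[OF e_mem, of w \<alpha>] ip_commute[OF e_mem kernel_mem, of w \<alpha>]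
  by (simp add: monomial_apply)

lemma coef_kernel: "w \<in> \<Omega> \<Longrightarrow> coef (kernel_fun \<Omega> k w) \<alpha> = a \<alpha> * cnj (multi_power w \<alpha>)"
  by (simp add: coef_def ip_kernel_monomial)

section \<open>The kernel series on the whole domain and totality of the monomials\<close>

lemma kernel_diagonal_summable:
  assumes w: "w \<in> \<Omega>"
  shows "(\<lambda>\<alpha>. a \<alpha> * (cmod (multi_power w \<alpha>))\<^sup>2) summable_on UNIV"
proof (rule nonneg_bounded_partial_sums_imp_summable_on)
  have "(\<Sum>\<alpha>\<in>F. a \<alpha> * (cmod (multi_power w \<alpha>))\<^sup>2) \<le> (ip_norm ip (kernel_fun \<Omega> k w))\<^sup>2" if "finite F" for F
    using Bessel[OF kernel_mem[OF w] that] by (simp add: ip_kernel_monomial w)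
  then show "eventually (\<lambda>F. (\<Sum>\<alpha>\<in>F. a \<alpha> * (cmod (multi_power w \<alpha>))\<^sup>2) \<le> (ip_norm ip (kernel_fun \<Omega> k w))\<^sup>2)
      (finite_subsets_at_top UNIV)"
    by (auto intro: eventually_finite_subsets_at_top_weakI)
qed (simp add: weight_pos less_imp_le)

text \<open>The modulus of a product is at most the sum of the two squares, so the diagonal series
  at \<open>z\<close> and at \<open>w\<close> together dominate.\<close>

lemma kernel_series_summable:
  assumes "z \<in> \<Omega>" "w \<in> \<Omega>"
  shows "(\<lambda>\<alpha>. a \<alpha> * cnj (multi_power w \<alpha>) * multi_power z \<alpha>) summable_on UNIV"
proof -
  have "(\<lambda>\<alpha>. cmod (a \<alpha> * cnj (multi_power w \<alpha>) * multi_power z \<alpha>)) summable_on UNIV"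
  proof (rule Infinite_Sum.abs_summable_on_comparison_test')
    show "(\<lambda>\<alpha>. a \<alpha> * (cmod (multi_power z \<alpha>))\<^sup>2 + a \<alpha> * (cmod (multi_power w \<alpha>))\<^sup>2) summable_on UNIV"
      by (intro summable_on_add kernel_diagonal_summable assms)
    fix \<alpha>
    have "cmod (multi_power w \<alpha>) * cmod (multi_power z \<alpha>)
        \<le> (cmod (multi_power z \<alpha>))\<^sup>2 + (cmod (multi_power w \<alpha>))\<^sup>2"
      using sum_squares_bound[of "cmod (multi_power w \<alpha>)" "cmod (multi_power z \<alpha>)"]
        mult_nonneg_nonneg[OF norm_ge_zero norm_ge_zero, of "multi_power w \<alpha>" "multi_power z \<alpha>"] by linarith
    then have "a \<alpha> * (cmod (multi_power w \<alpha>) * cmod (multi_power z \<alpha>))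
        \<le> a \<alpha> * ((cmod (multi_power z \<alpha>))\<^sup>2 + (cmod (multi_power w \<alpha>))\<^sup>2)"
      by (rule mult_left_mono) (simp add: weight_pos less_imp_le)
    then show "cmod (a \<alpha> * cnj (multi_power w \<alpha>) * multi_power z \<alpha>)
        \<le> a \<alpha> * (cmod (multi_power z \<alpha>))\<^sup>2 + a \<alpha> * (cmod (multi_power w \<alpha>))\<^sup>2"
      by (simp add: norm_mult weight_pos less_imp_le algebra_simps)
  qed
  then show ?thesis by (rule abs_summable_summable)
qed

text \<open>The series converges throughout \<Omega> and is holomorphic along lines there. It equals
  the kernel near the origin by \<open>expands_kernel_ex\<close>, hence everywhere by the identity
  theorem.\<close>

lemma kernel_series:
  assumes z: "z \<in> \<Omega>" and w: "w \<in> \<Omega>"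
  shows "((\<lambda>\<alpha>. a \<alpha> * cnj (multi_power w \<alpha>) * multi_power z \<alpha>) has_sum k z w) UNIV"
proof -
  define f where "f u = (\<Sum>\<^sub>\<infinity>\<alpha>. a \<alpha> * cnj (multi_power w \<alpha>) * multi_power u \<alpha>)" for u
  have f: "((\<lambda>\<alpha>. a \<alpha> * cnj (multi_power w \<alpha>) * multi_power u \<alpha>) has_sum f u) UNIV" if "u \<in> \<Omega>" for u
    unfolding f_def by (intro has_sum_infsum kernel_series_summable that w)
  obtain s where s: "s > 0" "expands (\<lambda>z. k z w) (\<lambda>\<alpha>. a \<alpha> * cnj (multi_power w \<alpha>)) s"
    using expands_kernel_ex[OF w] by blast
  have "k z w - f z = 0"
  proof (rule identity_theorem_several[where h = "\<lambda>u. k u w - f u", OF open_dom connected_dom _ zero_in_dom s(1) _ z])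
    show "line_holomorphic (\<lambda>u. k u w - f u) \<Omega>"
      by (intro line_holomorphic_diff kernel_holomorphic[OF w] power_series_line_holomorphic[OF open_dom f])
    fix u :: "complex ^ 'd" assume "u \<in> ball 0 s"
    then have "u \<in> polydisc s" using ball_subset_polydisc by blast
    then have "((\<lambda>\<alpha>. a \<alpha> * cnj (multi_power w \<alpha>) * multi_power u \<alpha>) has_sum k u w) UNIV"
      using s(2) by (simp add: expands_def)
    then show "k u w - f u = 0" by (simp add: f_def infsumI)
  qed
  then show ?thesis using f[OF z] by simp
qed

text \<open>The squared distance from the kernel function at \<open>w\<close> to its projection
  \<open>psum\<close> is \<open>k w w\<close> minus a partial sum of the diagonal series, which
  tends to 0. Since \<open>h\<close> is orthogonal to every projection, Cauchy-Schwarz forces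
  \<open>h w = 0\<close>.\<close>

lemma monomials_total:
  assumes h: "h \<in> H" and orth: "\<And>\<alpha>. ip h (monomial \<alpha>) = 0"
  shows "h = (\<lambda>z. 0)"
proof
  fix w
  show "h w = 0"
  proof (cases "w \<in> \<Omega>")
    case True
    let ?K = "kernel_fun \<Omega> k w"
    let ?s = "\<lambda>F. \<Sum>\<alpha>\<in>F. a \<alpha> * (cmod (multi_power w \<alpha>))\<^sup>2"
    have K: "?K \<in> H" using True by (rule kernel_mem)
    have "k w w = of_real ((ip_norm ip ?K)\<^sup>2)"
      using reproducing[OF K True] True by (simp add: kernel_fun_apply ip_self[OF K])
    then have "((\<lambda>\<alpha>. of_real (a \<alpha> * (cmod (multi_power w \<alpha>))\<^sup>2) :: complex) has_sum of_real ((ip_norm ip ?K)\<^sup>2)) UNIV"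
      using kernel_series[OF True True]
      by (simp add: complex_norm_square mult_ac del: of_real_power)
    then have "((\<lambda>\<alpha>. a \<alpha> * (cmod (multi_power w \<alpha>))\<^sup>2) has_sum (ip_norm ip ?K)\<^sup>2) UNIV"
      unfolding has_sum_of_real_iff .
    then have "(?s \<longlongrightarrow> (ip_norm ip ?K)\<^sup>2) (finite_subsets_at_top UNIV)"
      unfolding has_sum_def .
    then have lim: "((\<lambda>F. (ip_norm ip h)\<^sup>2 * ((ip_norm ip ?K)\<^sup>2 - ?s F)) \<longlongrightarrow>
        (ip_norm ip h)\<^sup>2 * ((ip_norm ip ?K)\<^sup>2 - (ip_norm ip ?K)\<^sup>2)) (finite_subsets_at_top UNIV)"
      by (intro tendsto_intros)
    have "(cmod (h w))\<^sup>2 \<le> (ip_norm ip h)\<^sup>2 * ((ip_norm ip ?K)\<^sup>2 - ?s F)" if F: "finite F" for F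
    proof -
      have "ip h (psum ?K F) = 0"
        unfolding psum_def by (subst ip_sum_right) (auto simp: e_mem h orth)
      then have "h w = ip h (\<lambda>z. ?K z - psum ?K F z)"
        using h True K by (simp add: reproducing ip_diff_right psum_mem)
      then have "cmod (h w) \<le> ip_norm ip h * ip_norm ip (\<lambda>z. ?K z - psum ?K F z)"
        using Cauchy_Schwarz[OF h diff_mem[OF K psum_mem]] by simp
      then have "(cmod (h w))\<^sup>2 \<le> (ip_norm ip h * ip_norm ip (\<lambda>z. ?K z - psum ?K F z))\<^sup>2"
        by (rule power_mono) simp
      then show ?thesis
        by (simp add: power_mult_distrib norm_diff_psum[OF K F] ip_kernel_monomial True)
    qed
    then have "(cmod (h w))\<^sup>2 \<le> (ip_norm ip h)\<^sup>2 * ((ip_norm ip ?K)\<^sup>2 - (ip_norm ip ?K)\<^sup>2)"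
      by (intro tendsto_lowerbound[OF lim] eventually_finite_subsets_at_top_weakI) auto
    then show ?thesis by simp
  qed (simp add: zero_outside h)
qed

lemma functional_expansion:
  fixes L :: "(complex ^ 'd \<Rightarrow> complex) \<Rightarrow> complex"
  assumes f: "f \<in> H" and L: "bounded_linear_functional H ip L"
  shows "((\<lambda>\<alpha>. coef f \<alpha> * L (monomial \<alpha>)) has_sum L f) UNIV"
proof (rule orthogonal_expansion[where A = "\<lambda>n. {\<alpha>. \<forall>i. \<alpha> $ i \<le> n}", OF monomials_total _ _ _ f L])
  show "finite {\<alpha> :: nat ^ 'd. \<forall>i. \<alpha> $ i \<le> n}" for n by (rule finite_multi_index_box)
  show "mono (\<lambda>n. {\<alpha> :: nat ^ 'd. \<forall>i. \<alpha> $ i \<le> n})" by (auto simp: mono_def intro: order_trans)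
  show "\<exists>n. \<alpha> \<in> {\<alpha> :: nat ^ 'd. \<forall>i. \<alpha> $ i \<le> n}" for \<alpha>
    by (rule exI[of _ "Max (range (vec_nth \<alpha>))"]) auto
qed

text \<open>Point evaluation at \<open>z\<close> is a bounded functional by the reproducing
  property, and its expansion over the monomials is the Taylor series.\<close>

lemma expands_coef:
  assumes f: "f \<in> H"
  shows "expands f (coef f) r"
  unfolding expands_def
proof
  fix z :: "complex ^ 'd" assume "z \<in> polydisc r"
  then have z: "z \<in> \<Omega>" using polydisc_subset by blast
  have "bounded_linear_functional H ip (\<lambda>f. f z)"
    unfolding bounded_linear_functional_def
  proof (intro conjI exI ballI allI)
    fix f assume "f \<in> H"
    then show "cmod (f z) \<le> ip_norm ip (kernel_fun \<Omega> k z) * ip_norm ip f"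
      using Cauchy_Schwarz[OF _ kernel_mem[OF z], of f] z by (simp add: reproducing mult.commute)
  qed auto
  then show "((\<lambda>\<alpha>. coef f \<alpha> * multi_power z \<alpha>) has_sum f z) UNIV"
    using functional_expansion[OF f, of "\<lambda>f. f z"] by (simp add: monomial_apply z)
qed

subsection \<open>Multiplicative functionals\<close>

text \<open>Both sides are coefficients of expansions of the product on \<open>polydisc r\<close>,
  and these are unique.\<close>

lemma coef_mult:
  assumes "f \<in> H" "g \<in> H" "(\<lambda>z. f z * g z) \<in> H"
  shows "coef (\<lambda>z. f z * g z) \<gamma> = (\<Sum>p\<in>splittings \<gamma>. coef f (fst p) * coef g (snd p))"
  using coef_expands[OF assms(3) expands_mult[OF expands_coef expands_coef] r_pos] assms(1,2)
  by (simp add: fun_eq_iff)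

text \<open>The values \<open>multi_power p\<close> are multiplicative in the exponent, so the
  Cauchy product of the expansions of \<open>L f\<close> and \<open>L g\<close> regroups into that
  of \<open>L\<close> at the product. Convergence comes from boundedness of \<open>L\<close>, so
  \<open>p\<close> may be any vector.\<close>

lemma multiplicative_if_monomial_powers:
  fixes L :: "(complex ^ 'd \<Rightarrow> complex) \<Rightarrow> complex"
  assumes L: "bounded_linear_functional H ip L"
    and p: "\<And>\<alpha>. L (monomial \<alpha>) = multi_power p \<alpha>"
  shows "multiplicative_functional H L"
  unfolding multiplicative_functional_def
proof (intro ballI impI)
  fix f g assume fg: "f \<in> H" "g \<in> H" "(\<lambda>z. f z * g z) \<in> H"
  have "((\<lambda>\<gamma>. \<Sum>q\<in>splittings \<gamma>. coef f (fst q) * L (monomial (fst q)) * (coef g (snd q) * L (monomial (snd q))))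
      has_sum L f * L g) UNIV"
    by (intro Cauchy_product_multi functional_expansion fg L)
  moreover have "(\<Sum>q\<in>splittings \<gamma>. coef f (fst q) * L (monomial (fst q)) * (coef g (snd q) * L (monomial (snd q))))
      = coef (\<lambda>z. f z * g z) \<gamma> * L (monomial \<gamma>)" for \<gamma>
    unfolding coef_mult[OF fg] sum_distrib_right p
    by (rule sum.cong) (auto simp: splittings_def multi_power_add)
  ultimately have "((\<lambda>\<gamma>. coef (\<lambda>z. f z * g z) \<gamma> * L (monomial \<gamma>)) has_sum L f * L g) UNIV" by simp
  then show "L (\<lambda>z. f z * g z) = L f * L g"
    using functional_expansion[OF fg(3) L] has_sum_unique by blast
qed

lemma kernel_square_coefficients:
  fixes L :: "(complex ^ 'd \<Rightarrow> complex) \<Rightarrow> complex"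
  assumes L: "bounded_linear_functional H ip L"
    and sq: "\<And>w. w \<in> \<Omega> \<Longrightarrow> (\<lambda>z. (kernel_fun \<Omega> k w z)\<^sup>2) \<in> H"
    and L_sq: "\<And>w. w \<in> \<Omega> \<Longrightarrow> L (\<lambda>z. (kernel_fun \<Omega> k w z)\<^sup>2) = (L (kernel_fun \<Omega> k w))\<^sup>2"
  shows "(\<Sum>p\<in>splittings \<gamma>. a (fst p) * a (snd p) * L (monomial \<gamma>))
    = (\<Sum>p\<in>splittings \<gamma>. a (fst p) * a (snd p) * (L (monomial (fst p)) * L (monomial (snd p))))"
proof -
  \<comment> \<open>Kernel functions are anti-holomorphic in their index; conjugating the index
    gives genuine power series in \<open>z\<close>, whose coefficients can be compared.\<close>
  define conj_vec :: "complex ^ 'd \<Rightarrow> complex ^ 'd" where "conj_vec z = (\<chi> i. cnj (z $ i))" for z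
  have conj: "conj_vec z \<in> \<Omega>" if "z \<in> polydisc r" for z
    using that polydisc_subset by (auto simp: conj_vec_def polydisc_def)
  let ?K = "\<lambda>z. kernel_fun \<Omega> k (conj_vec z)"
  have 1: "expands (\<lambda>z. L (?K z)) (\<lambda>\<alpha>. a \<alpha> * L (monomial \<alpha>)) r"
    unfolding expands_def
  proof
    fix z :: "complex ^ 'd" assume z: "z \<in> polydisc r"
    show "((\<lambda>\<alpha>. a \<alpha> * L (monomial \<alpha>) * multi_power z \<alpha>) has_sum L (?K z)) UNIV"
      using functional_expansion[OF kernel_mem[OF conj[OF z]] L]
      unfolding coef_kernel[OF conj[OF z]] by (simp add: conj_vec_def multi_power_cnj mult_ac)
  qed
  \<comment> \<open>This expansion arises from applying \<open>L\<close> to the squared kernel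
    function; the other one, from squaring series 1, is supplied by
    \<open>expands_mult\<close>.\<close>
  have 2: "expands (\<lambda>z. L (?K z) * L (?K z)) (\<lambda>\<gamma>. \<Sum>p\<in>splittings \<gamma>. a (fst p) * a (snd p) * L (monomial \<gamma>)) r"
    unfolding expands_def
  proof
    fix z :: "complex ^ 'd" assume z: "z \<in> polydisc r"
    have w: "conj_vec z \<in> \<Omega>" by (rule conj[OF z])
    have sq': "(\<lambda>u. ?K z u * ?K z u) \<in> H" using sq[OF w] by (simp add: power2_eq_square)
    have "coef (\<lambda>u. ?K z u * ?K z u) \<gamma> * L (monomial \<gamma>)
        = (\<Sum>p\<in>splittings \<gamma>. a (fst p) * a (snd p) * L (monomial \<gamma>)) * multi_power z \<gamma>" for \<gamma>
      unfolding coef_mult[OF kernel_mem[OF w] kernel_mem[OF w] sq'] sum_distrib_right coef_kernel[OF w]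
      by (rule sum.cong) (auto simp: splittings_def conj_vec_def multi_power_cnj multi_power_add)
    moreover have "L (\<lambda>u. ?K z u * ?K z u) = L (?K z) * L (?K z)"
      using L_sq[OF w] by (simp add: power2_eq_square)
    ultimately show "((\<lambda>\<gamma>. (\<Sum>p\<in>splittings \<gamma>. a (fst p) * a (snd p) * L (monomial \<gamma>)) * multi_power z \<gamma>)
        has_sum L (?K z) * L (?K z)) UNIV"
      using functional_expansion[OF sq' L] by simp
  qed
  show ?thesis
    using fun_cong[OF expands_unique[OF 2 expands_mult[OF 1 1] r_pos], of \<gamma>] by (simp add: mult_ac)
qed

text \<open>Strong induction on the degree. In the identity
  \<open>kernel_square_coefficients\<close>, a splitting with a zero part contributes nothing since
  \<open>L\<close> is 1 on the constant; by induction every other splitting contributes a positive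
  weight times the same defect \<open>?D\<close>.\<close>

lemma functional_monomial_powers:
  fixes L :: "(complex ^ 'd \<Rightarrow> complex) \<Rightarrow> complex"
  assumes L: "bounded_linear_functional H ip L"
    and L_1: "L (monomial 0) = 1"
    and sq: "\<And>w. w \<in> \<Omega> \<Longrightarrow> (\<lambda>z. (kernel_fun \<Omega> k w z)\<^sup>2) \<in> H"
    and L_sq: "\<And>w. w \<in> \<Omega> \<Longrightarrow> L (\<lambda>z. (kernel_fun \<Omega> k w z)\<^sup>2) = (L (kernel_fun \<Omega> k w))\<^sup>2"
  shows "L (monomial \<gamma>) = multi_power (\<chi> i. L (monomial (axis i 1))) \<gamma>"
proof (induction "multi_degree \<gamma>" arbitrary: \<gamma> rule: less_induct)
  case less
  define p :: "complex ^ 'd" where "p = (\<chi> i. L (monomial (axis i 1)))"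
  \<comment> \<open>Degrees 0 and 1 admit no splitting into two nonzero parts: the first is the
    normalisation, the second defines the point \<open>p\<close>.\<close>
  consider "multi_degree \<gamma> = 0" | "multi_degree \<gamma> = 1" | "multi_degree \<gamma> \<ge> 2" by linarith
  then have "L (monomial \<gamma>) = multi_power p \<gamma>"
  proof cases
    case 1
    then show ?thesis by (simp add: multi_degree_eq_0_iff L_1)
  next
    case 2
    then obtain i where "\<gamma> = axis i 1" by (rule multi_degree_eq_1)
    then show ?thesis by (simp add: multi_power_axis p_def del: One_nat_def)
  next
    case 3
    let ?D = "L (monomial \<gamma>) - multi_power p \<gamma>"
    define T where "T = {q \<in> splittings \<gamma>. fst q \<noteq> 0 \<and> snd q \<noteq> 0}"
    have "finite T" unfolding T_def by (simp add: finite_splittings)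
    have split_term: "L (monomial \<gamma>) - L (monomial (fst q)) * L (monomial (snd q)) = (if q \<in> T then ?D else 0)"
      if "q \<in> splittings \<gamma>" for q
    proof (cases "q \<in> T")
      case True
      then have q: "fst q + snd q = \<gamma>" "multi_degree (fst q) > 0" "multi_degree (snd q) > 0"
        by (auto simp: T_def splittings_def multi_degree_eq_0_iff intro: gr0I)
      then have "multi_degree (fst q) < multi_degree \<gamma>" "multi_degree (snd q) < multi_degree \<gamma>"
        by (auto simp: multi_degree_add)
      then have "L (monomial (fst q)) = multi_power p (fst q)" "L (monomial (snd q)) = multi_power p (snd q)"
        unfolding p_def by (simp_all only: less)
      then show ?thesis using q(1) True by (auto simp: multi_power_add)
    next
      case False
      then show ?thesis using that by (auto simp: T_def splittings_def L_1)
    qed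
    have "0 = (\<Sum>q\<in>splittings \<gamma>. a (fst q) * a (snd q) *
        (L (monomial \<gamma>) - L (monomial (fst q)) * L (monomial (snd q))))"
      using kernel_square_coefficients[OF L sq L_sq, of \<gamma>] by (simp add: right_diff_distrib sum_subtractf)
    also have "\<dots> = (\<Sum>q\<in>splittings \<gamma>. if q \<in> T then a (fst q) * a (snd q) * ?D else 0)"
      by (rule sum.cong) (simp_all add: split_term)
    also have "\<dots> = (\<Sum>q\<in>T. a (fst q) * a (snd q) * ?D)"
      by (rule sum.mono_neutral_cong_right) (auto simp: T_def finite_splittings)
    also have "\<dots> = of_real (\<Sum>q\<in>T. a (fst q) * a (snd q)) * ?D"
      by (simp add: sum_distrib_right)
    finally have "of_real (\<Sum>q\<in>T. a (fst q) * a (snd q)) * ?D = 0" by simp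
    moreover have "(\<Sum>q\<in>T. a (fst q) * a (snd q)) > 0"
    proof (rule sum_pos)
      have "\<gamma> \<noteq> 0" using 3 by (auto simp: multi_degree_def)
      then obtain i where i: "\<gamma> $ i > 0" by (auto simp: vec_eq_iff)
      \<comment> \<open>One unit is split off in coordinate \<open>i\<close>; the remainder is
        nonzero because the degree is at least 2, so \<open>T\<close> is nonempty and the total
        weight is positive.\<close>
      define \<beta> where "\<beta> = (\<chi> j. if j = i then \<gamma> $ i - 1 else \<gamma> $ j)"
      have split: "axis i 1 + \<beta> = \<gamma>"
        using i by (auto simp: vec_eq_iff axis_def \<beta>_def)
      have "multi_degree (axis i 1 :: nat ^ 'd) = 1"
        by (simp add: multi_degree_def axis_def)
      then have "\<beta> \<noteq> 0" "(axis i 1 :: nat ^ 'd) \<noteq> 0"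
        using 3 split multi_degree_add[of "axis i 1" \<beta>] by (auto simp: multi_degree_def)
      then have "(axis i 1, \<beta>) \<in> T" using split by (simp add: T_def splittings_def del: One_nat_def)
      then show "T \<noteq> {}" by blast
    qed (auto simp: weight_pos \<open>finite T\<close>)
    ultimately have "?D = 0" unfolding mult_eq_0_iff of_real_eq_0_iff by linarith
    then show ?thesis by simp
  qed
  then show ?case by (simp add: p_def)
qed

end

theorem theorem1:
  fixes \<Omega> :: "(complex ^ 'd) set"
    and k :: "complex ^ 'd \<Rightarrow> complex ^ 'd \<Rightarrow> complex"
    and H :: "(complex ^ 'd \<Rightarrow> complex) set"
    and ip :: "(complex ^ 'd \<Rightarrow> complex) \<Rightarrow> (complex ^ 'd \<Rightarrow> complex) \<Rightarrow> complex"
    and \<Lambda> :: "(complex ^ 'd \<Rightarrow> complex) \<Rightarrow> complex"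
  assumes "open \<Omega>" and "connected \<Omega>" and "0 \<in> \<Omega>"
    and "diagonal_holomorphic_kernel \<Omega> k"
    and "rkhs \<Omega> k H ip"
    and "\<And>w. w \<in> \<Omega> \<Longrightarrow> (\<lambda>z. (kernel_fun \<Omega> k w z)\<^sup>2) \<in> H"
    and "bounded_linear_functional H ip \<Lambda>"
    and "\<Lambda> (zero_ext \<Omega> (\<lambda>z. 1)) = 1"
  shows "multiplicative_functional H \<Lambda> \<longleftrightarrow>
    (\<forall>w\<in>\<Omega>. \<Lambda> (\<lambda>z. (kernel_fun \<Omega> k w z)\<^sup>2) = (\<Lambda> (kernel_fun \<Omega> k w))\<^sup>2)"
proof
  assume mult: "multiplicative_functional H \<Lambda>"
  show "\<forall>w\<in>\<Omega>. \<Lambda> (\<lambda>z. (kernel_fun \<Omega> k w z)\<^sup>2) = (\<Lambda> (kernel_fun \<Omega> k w))\<^sup>2"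
  proof
    fix w assume w: "w \<in> \<Omega>"
    show "\<Lambda> (\<lambda>z. (kernel_fun \<Omega> k w z)\<^sup>2) = (\<Lambda> (kernel_fun \<Omega> k w))\<^sup>2"
      using mult assms(6)[OF w] rkhs.kernel_mem[OF assms(5) w]
      unfolding multiplicative_functional_def power2_eq_square by blast
  qed
next
  assume sq: "\<forall>w\<in>\<Omega>. \<Lambda> (\<lambda>z. (kernel_fun \<Omega> k w z)\<^sup>2) = (\<Lambda> (kernel_fun \<Omega> k w))\<^sup>2"
  obtain a r where a: "\<And>\<alpha>. a \<alpha> > 0" and r: "r > 0" "ball 0 r \<subseteq> \<Omega>"
    and series: "\<And>z w. z \<in> ball 0 r \<Longrightarrow> w \<in> ball 0 r \<Longrightarrow>
      ((\<lambda>\<alpha>. complex_of_real (a \<alpha>) * multi_power z \<alpha> * cnj (multi_power w \<alpha>)) has_sum k z w) UNIV"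
    using assms(4) unfolding diagonal_holomorphic_kernel_def by blast
  have sub: "polydisc (r / CARD('d)) \<subseteq> (ball 0 r :: (complex ^ 'd) set)"
    using r(1) by (rule polydisc_subset_ball)
  interpret rkhs \<Omega> k H ip by fact
  \<comment> \<open>Division by the dimension fits the polydisc into the ball on which the expansion
    is given.\<close>
  interpret diagonal_rkhs \<Omega> k H ip a "r / CARD('d)"
  proof
    show "line_holomorphic (\<lambda>z. k z w) \<Omega>" if "w \<in> \<Omega>" for w
      using assms(4) that unfolding diagonal_holomorphic_kernel_def
      by (intro holomorphic_several_line_holomorphic) blast
  qed (use assms(1,2) a r series sub in \<open>auto simp: subset_iff\<close>)
  have "\<Lambda> (monomial 0) = 1" using assms(8) by (simp add: monomial_def)
  then have "\<Lambda> (monomial \<gamma>) = multi_power (\<chi> i. \<Lambda> (monomial (axis i 1))) \<gamma>" for \<gamma>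
    using functional_monomial_powers[OF assms(7) _ assms(6)] sq by blast
  then show "multiplicative_functional H \<Lambda>"
    by (rule multiplicative_if_monomial_powers[OF assms(7)])
qed

end
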